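(* Let $r\ge 1$, let $p_{1},\dots,p_{r}$ be positive distinct integers and set $E=\{p_{1}^{k_{1}}\cdots p_{r}^{k_{r}} : k_{1}\ge 0,\dots,k_{r}\ge 0\}$. There exists a continuous probability measure $\mu$ on $\mathbb{T}$ such that $$\inf_{k_{1}\ge 0,\dots,k_{r}\ge 0}\bigl|\widehat{\mu}(p_{1}^{k_{1}}\cdots p_{r}^{k_{r}})\bigr|>0.$$ Equivalently, $\widetilde{\mathrm{Kaz}}(E)<\sqrt{2}$.
   Context: $\mathbb{T}=\{\lambda\in\mathbb{C} : |\lambda|=1\}$. For a finite complex Borel measure $\mu$ on $\mathbb{T}$ and $n\in\mathbb{Z}$, $\widehat{\mu}(n)=\int_{\mathbb{T}}\lambda^{n}\,d\mu(\lambda)$. A Borel probability measure $\mu$ on $\mathbb{T}$ is continuous if $\mu(\{\lambda\})=0$ for every $\lambda\in\mathbb{T}$. For $Q\subseteq\mathbb{Z}$, the modified Kazhdan constant is $\widetilde{\mathrm{Kaz}}(Q)=\inf_{V}\inf_{\|x\|=1}\sup_{q\in Q}\|V^{q}x-x\|$, where the first infimum is over all unitary operators $V$ without eigenvalues acting on a complex separable Hilbert space $H$ and the second over unit vectors $x\in H$. *)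

theory Defs
  imports "HOL-Probability.Probability" "HOL-Algebra.Module"
begin

section \<open>Measures on the unit circle\<close>

abbreviation unit_circle :: "complex set" where
  "unit_circle \<equiv> sphere 0 1"

definition continuous_circle_prob :: "complex measure \<Rightarrow> bool" where
  "continuous_circle_prob M \<longleftrightarrow>
     prob_space M \<and> sets M = sets (restrict_space borel unit_circle) \<and>
     (\<forall>z\<in>unit_circle. measure M {z} = 0)"

text \<open>No complex conjugation in the kernel: the coefficient of index \<open>n\<close> integrates \<open>z\<^sup>n\<close>.\<close>

definition circle_fourier :: "complex measure \<Rightarrow> int \<Rightarrow> complex" where
  "circle_fourier M n = (LINT z|M. z powi n)"


section \<open>Complex Hilbert spaces on carrier sets\<close>

text \<open>
  The modified Kazhdan constant is an infimum over all separable complex Hilbert spaces, so Hilbert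
  spaces are needed as values. They are records extending the modules of HOL-Algebra; the
  multiplicative fields \<open>mult\<close> and \<open>one\<close> inherited from rings are unconstrained and play no role.
\<close>

definition complex_ring :: "complex ring" where
  "complex_ring = \<lparr>carrier = UNIV, monoid.mult = (*), one = 1, zero = 0, add = (+)\<rparr>"

record 'a cip_space = "(complex, 'a) module" +
  cip :: "'a \<Rightarrow> 'a \<Rightarrow> complex"

locale complex_inner_space = module complex_ring H for H :: "'a cip_space" (structure) +
  assumes cip_add_left: "\<lbrakk>x \<in> carrier H; y \<in> carrier H; z \<in> carrier H\<rbrakk> \<Longrightarrow>
      cip H (x \<oplus> y) z = cip H x z + cip H y z"
    and cip_smult_left: "\<lbrakk>x \<in> carrier H; y \<in> carrier H\<rbrakk> \<Longrightarrow>
      cip H (a \<odot> x) y = a * cip H x y"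
    and cip_cnj: "\<lbrakk>x \<in> carrier H; y \<in> carrier H\<rbrakk> \<Longrightarrow> cip H y x = cnj (cip H x y)"
    and cip_ge_zero: "x \<in> carrier H \<Longrightarrow> 0 \<le> Re (cip H x x)"
    and cip_eq_zero: "\<lbrakk>x \<in> carrier H; cip H x x = 0\<rbrakk> \<Longrightarrow> x = \<zero>"

definition cnorm :: "'a cip_space \<Rightarrow> 'a \<Rightarrow> real" where
  "cnorm H x = sqrt (Re (cip H x x))"

text \<open>The value off the carrier is fixed because \<open>Metric_space\<close> requires symmetry and
  nonnegativity of the distance on the whole type.\<close>

definition cdist :: "'a cip_space \<Rightarrow> 'a \<Rightarrow> 'a \<Rightarrow> real" where
  "cdist H x y =
     (if x \<in> carrier H \<and> y \<in> carrier H then cnorm H (x \<ominus>\<^bsub>H\<^esub> y) else 0)"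

locale separable_hilbert_space = complex_inner_space +
  assumes complete: "Metric_space.mcomplete (carrier H) (cdist H)"
    and separable: "separable_space (Metric_space.mtopology (carrier H) (cdist H))"

definition unitary_operator :: "'a cip_space \<Rightarrow> ('a \<Rightarrow> 'a) \<Rightarrow> bool" where
  "unitary_operator H V \<longleftrightarrow>
     bij_betw V (carrier H) (carrier H) \<and>
     (\<forall>x\<in>carrier H. \<forall>y\<in>carrier H. V (x \<oplus>\<^bsub>H\<^esub> y) = V x \<oplus>\<^bsub>H\<^esub> V y) \<and>
     (\<forall>a. \<forall>x\<in>carrier H. V (a \<odot>\<^bsub>H\<^esub> x) = a \<odot>\<^bsub>H\<^esub> V x) \<and>
     (\<forall>x\<in>carrier H. \<forall>y\<in>carrier H. cip H (V x) (V y) = cip H x y)"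

definition is_eigenvalue :: "'a cip_space \<Rightarrow> ('a \<Rightarrow> 'a) \<Rightarrow> complex \<Rightarrow> bool" where
  "is_eigenvalue H V a \<longleftrightarrow> (\<exists>x\<in>carrier H. x \<noteq> \<zero>\<^bsub>H\<^esub> \<and> V x = a \<odot>\<^bsub>H\<^esub> x)"

definition op_powi :: "'a cip_space \<Rightarrow> ('a \<Rightarrow> 'a) \<Rightarrow> int \<Rightarrow> 'a \<Rightarrow> 'a" where
  "op_powi H V q = (if q \<ge> 0 then V ^^ nat q else inv_into (carrier H) V ^^ nat (- q))"


section \<open>The modified Kazhdan constant\<close>

text \<open>
  The infimum of the displacements of unit vectors. Values are extended nonnegative reals, so an
  empty supremum is \<open>0\<close> and an empty infimum is \<open>\<infinity>\<close>; in particular the zero space, whose only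
  operator has no eigenvalue, does not affect the constant below.
\<close>

definition min_displacement :: "int set \<Rightarrow> 'a cip_space \<Rightarrow> ('a \<Rightarrow> 'a) \<Rightarrow> ennreal" where
  "min_displacement Q H V =
     (INF x\<in>{x \<in> carrier H. cnorm H x = 1}.
        SUP q\<in>Q. ennreal (cnorm H (op_powi H V q x \<ominus>\<^bsub>H\<^esub> x)))"

text \<open>
  A separable Hilbert space has at most continuum many points, hence is isomorphic to one whose
  carrier is a set of complex sequences. Restricting the infimum to such carriers therefore loses
  nothing; \<open>modified_kazhdan_le\<close> below proves this.
\<close>

definition modified_kazhdan :: "int set \<Rightarrow> ennreal" where
  "modified_kazhdan Q =
     (INF (H, V)\<in>{(H :: (nat \<Rightarrow> complex) cip_space, V).
          separable_hilbert_space H \<and> unitary_operator H V \<and> \<not> (\<exists>a. is_eigenvalue H V a)}.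
        min_displacement Q H V)"



section \<open>Independence of the carrier type\<close>

context complex_inner_space
begin

lemma smult_in_carrier: "x \<in> carrier H \<Longrightarrow> a \<odot> x \<in> carrier H"
  by (rule smult_closed) (simp_all add: complex_ring_def)

lemma a_inv_eq_smult: "x \<in> carrier H \<Longrightarrow> \<ominus> x = (- 1) \<odot> x"
proof -
  assume x: "x \<in> carrier H"
  have "(- 1 + 1) \<odot> x = (- 1) \<odot> x \<oplus> 1 \<odot> x"
    using smult_l_distr[of "- 1" 1 x] x by (simp add: complex_ring_def)
  moreover have "1 \<odot> x = x" using smult_one[OF x] by (simp add: complex_ring_def)
  moreover have "0 \<odot> x = \<zero>" using smult_l_null[OF x] by (simp add: complex_ring_def)
  ultimately have "(- 1) \<odot> x \<oplus> x = \<zero>" by simp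
  then show ?thesis using x smult_in_carrier M.minus_equality by blast
qed

lemma minus_eq_smult: "\<lbrakk>x \<in> carrier H; y \<in> carrier H\<rbrakk> \<Longrightarrow> x \<ominus> y = x \<oplus> (- 1) \<odot> y"
  by (simp add: a_minus_def a_inv_eq_smult)

lemma cip_add_right: "\<lbrakk>x \<in> carrier H; y \<in> carrier H; z \<in> carrier H\<rbrakk> \<Longrightarrow>
    cip H z (x \<oplus> y) = cip H z x + cip H z y"
  by (metis M.a_closed cip_add_left cip_cnj complex_cnj_add)

lemma cip_smult_right: "\<lbrakk>x \<in> carrier H; y \<in> carrier H\<rbrakk> \<Longrightarrow>
    cip H y (a \<odot> x) = cnj a * cip H y x"
  by (metis cip_cnj cip_smult_left complex_cnj_mult smult_in_carrier)

lemma cip_self: "x \<in> carrier H \<Longrightarrow> cip H x x = of_real (Re (cip H x x))"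
  using cip_cnj[of x x] by (simp add: complex_eq_iff)

lemma cip_zero_left: "x \<in> carrier H \<Longrightarrow> cip H \<zero> x = 0"
  using cip_smult_left[of x x 0] smult_l_null[of x] by (simp add: complex_ring_def)

lemma cnorm_nonneg: "x \<in> carrier H \<Longrightarrow> 0 \<le> cnorm H x"
  by (simp add: cnorm_def cip_ge_zero)

lemma cnorm_sq: "x \<in> carrier H \<Longrightarrow> (cnorm H x)\<^sup>2 = Re (cip H x x)"
  by (simp add: cnorm_def cip_ge_zero)

lemma cnorm_eq_zero: "x \<in> carrier H \<Longrightarrow> cnorm H x = 0 \<longleftrightarrow> x = \<zero>"
  by (metis cip_eq_zero cip_self cip_zero_left cnorm_def of_real_0 real_sqrt_eq_zero_cancel_iff
      zero_complex.simps(1))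

lemma Cauchy_Schwarz:
  assumes x: "x \<in> carrier H" and y: "y \<in> carrier H"
  shows "cmod (cip H x y) \<le> cnorm H x * cnorm H y"
proof (cases "y = \<zero>")
  case True
  have "cip H x y = 0" using True cip_cnj[OF y x] cip_zero_left[OF x] by simp
  then show ?thesis by (simp add: cnorm_nonneg x y)
next
  case False
  define n where "n = Re (cip H y y)"
  have yy: "cip H y y = of_real n" using cip_self[OF y] by (simp add: n_def)
  have n: "n > 0" using cip_ge_zero[OF y] cip_eq_zero[OF y] False yy
    by (metis n_def less_eq_real_def of_real_0)
  define c where "c = cip H x y / of_real n"
  define z where "z = x \<oplus> (- c) \<odot> y"
  have cy: "(- c) \<odot> y \<in> carrier H" by (rule smult_in_carrier[OF y])
  have z: "z \<in> carrier H" unfolding z_def using x cy by simp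
  have "cip H z z = cip H x x - cnj c * cip H x y - c * cnj (cip H x y) + c * cnj c * of_real n"
    unfolding z_def
    by (simp add: cip_add_left cip_add_right cip_smult_left cip_smult_right x y cy
        yy cip_cnj[OF x y] algebra_simps)
  also have "\<dots> = cip H x x - of_real ((cmod (cip H x y))\<^sup>2 / n)"
    using n by (simp add: c_def field_simps complex_norm_square[symmetric] power2_eq_square)
  finally have "0 \<le> Re (cip H x x) - (cmod (cip H x y))\<^sup>2 / n"
    using cip_ge_zero[OF z] by simp
  then have "(cmod (cip H x y))\<^sup>2 \<le> (cnorm H x * cnorm H y)\<^sup>2"
    using n by (simp add: field_simps power_mult_distrib cnorm_sq x y n_def[symmetric])
  then show ?thesis
    by (rule power2_le_imp_le) (simp add: cnorm_nonneg x y)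
qed

lemma cnorm_triangle:
  assumes x: "x \<in> carrier H" and y: "y \<in> carrier H"
  shows "cnorm H (x \<oplus> y) \<le> cnorm H x + cnorm H y"
proof (rule power2_le_imp_le)
  have "(cnorm H (x \<oplus> y))\<^sup>2 = Re (cip H x x) + Re (cip H y y) + 2 * Re (cip H x y)"
    using x y by (simp add: cnorm_sq cip_add_left cip_add_right cip_cnj[OF x y])
  also have "\<dots> \<le> (cnorm H x)\<^sup>2 + (cnorm H y)\<^sup>2 + 2 * (cnorm H x * cnorm H y)"
    using Cauchy_Schwarz[OF x y] complex_Re_le_cmod[of "cip H x y"] x y by (simp add: cnorm_sq)
  finally show "(cnorm H (x \<oplus> y))\<^sup>2 \<le> (cnorm H x + cnorm H y)\<^sup>2"
    by (simp add: power2_sum)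
qed (simp add: cnorm_nonneg x y)

lemma cnorm_smult: "x \<in> carrier H \<Longrightarrow> cnorm H (a \<odot> x) = cmod a * cnorm H x"
proof -
  assume x: "x \<in> carrier H"
  have "cip H (a \<odot> x) (a \<odot> x) = of_real ((cmod a)\<^sup>2) * cip H x x"
    using complex_norm_square[of a]
    by (simp add: cip_smult_left cip_smult_right x smult_in_carrier mult_ac)
  then show ?thesis
    by (simp add: cnorm_def real_sqrt_mult)
qed

lemma Metric_space_cdist: "Metric_space (carrier H) (cdist H)"
proof
  fix x y z
  show "0 \<le> cdist H x y" by (simp add: cdist_def cnorm_nonneg)
  show "cdist H x y = cdist H y x"
  proof (cases "x \<in> carrier H \<and> y \<in> carrier H")
    case True
    then have "y \<ominus> x = \<ominus> (x \<ominus> y)" by (simp add: M.minus_add a_minus_def M.a_comm)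
    then have "y \<ominus> x = (- 1) \<odot> (x \<ominus> y)" using True by (simp add: a_inv_eq_smult)
    then show ?thesis using True by (simp add: cdist_def cnorm_smult)
  qed (auto simp: cdist_def)
  {
    assume "x \<in> carrier H" "y \<in> carrier H"
    then show "cdist H x y = 0 \<longleftrightarrow> x = y"
      by (metis M.minus_closed M.minus_eq M.r_neg M.add.inv_equality M.minus_minus M.a_inv_closed
          cdist_def cnorm_eq_zero)
  next
    assume x: "x \<in> carrier H" and y: "y \<in> carrier H" and z: "z \<in> carrier H"
    have "x \<ominus> z = (x \<ominus> y) \<oplus> (y \<ominus> z)"
      using x y z by (simp add: a_minus_def M.a_assoc M.r_neg1 M.r_neg2)
    then show "cdist H x z \<le> cdist H x y + cdist H y z"
      using x y z cnorm_triangle[of "x \<ominus> y" "y \<ominus> z"] by (simp add: cdist_def)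
  }
qed

end

lemma (in separable_hilbert_space) inj_into_sequences:
  "\<exists>f :: 'a \<Rightarrow> nat \<Rightarrow> complex. inj_on f (carrier H)"
proof -
  interpret D: Metric_space "carrier H" "cdist H" by (rule Metric_space_cdist)
  obtain C where C: "countable C" "C \<subseteq> carrier H" "D.mtopology closure_of C = carrier H"
    using separable by (auto simp: separable_space_def)
  define f where "f x = (\<lambda>n. complex_of_real (cdist H x (from_nat_into C n)))" for x
  have ne: "C \<noteq> {}" using C(3) by force
  have "x = y" if x: "x \<in> carrier H" and y: "y \<in> carrier H" and eq: "f x = f y" for x y
  proof (rule ccontr)
    assume "x \<noteq> y"
    then have pos: "cdist H x y / 2 > 0" using x y D.mdist_pos_less by simp
    then obtain c where c: "c \<in> C" "c \<in> D.mball x (cdist H x y / 2)"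
      using C(3) x unfolding D.metric_closure_of by blast
    obtain n where "c = from_nat_into C n" using c C by (metis from_nat_into_surj)
    then have "cdist H x c = cdist H y c" using fun_cong[OF eq, of n] by (simp add: f_def)
    then show False
      using c(2) D.triangle[OF x _ y, of c] D.commute[of c y] by (auto simp: D.in_mball)
  qed
  then have "inj_on f (carrier H)" by (rule inj_onI)
  then show ?thesis by blast
qed

definition transport :: "('a \<Rightarrow> 'b) \<Rightarrow> 'a cip_space \<Rightarrow> 'b cip_space" where
  "transport f H = (let g = inv_into (carrier H) f in
     \<lparr>carrier = f ` carrier H, monoid.mult = (\<lambda>_ _. undefined), one = undefined,
      zero = f \<zero>\<^bsub>H\<^esub>, add = (\<lambda>x y. f (g x \<oplus>\<^bsub>H\<^esub> g y)),
      smult = (\<lambda>a x. f (a \<odot>\<^bsub>H\<^esub> g x)), cip = (\<lambda>x y. cip H (g x) (g y))\<rparr>)"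

locale transported = complex_inner_space H for H :: "'a cip_space" (structure) +
  fixes f :: "'a \<Rightarrow> 'b"
  assumes inj: "inj_on f (carrier H)"
begin

abbreviation "K \<equiv> transport f H"

lemma K_simps [simp]:
  "carrier K = f ` carrier H"
  "\<zero>\<^bsub>K\<^esub> = f \<zero>"
  "\<lbrakk>x \<in> carrier H; y \<in> carrier H\<rbrakk> \<Longrightarrow> f x \<oplus>\<^bsub>K\<^esub> f y = f (x \<oplus> y)"
  "x \<in> carrier H \<Longrightarrow> a \<odot>\<^bsub>K\<^esub> f x = f (a \<odot> x)"
  "\<lbrakk>x \<in> carrier H; y \<in> carrier H\<rbrakk> \<Longrightarrow> cip K (f x) (f y) = cip H x y"
  by (simp_all add: transport_def Let_def inv_into_f_f[OF inj])

lemma f_eq_iff: "\<lbrakk>x \<in> carrier H; y \<in> carrier H\<rbrakk> \<Longrightarrow> f x = f y \<longleftrightarrow> x = y"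
  using inj by (auto dest: inj_onD)

lemma inner_space_K: "complex_inner_space K"
proof -
  have grp: "abelian_group K"
  proof (rule abelian_groupI)
    show "\<exists>y\<in>carrier K. y \<oplus>\<^bsub>K\<^esub> x = \<zero>\<^bsub>K\<^esub>" if "x \<in> carrier K" for x
    proof -
      obtain u where u: "x = f u" "u \<in> carrier H" using \<open>x \<in> carrier K\<close> by auto
      then have "f (\<ominus> u) \<oplus>\<^bsub>K\<^esub> x = \<zero>\<^bsub>K\<^esub>" by (simp add: M.l_neg)
      then show ?thesis using u by (metis K_simps(1) M.a_inv_closed image_eqI)
    qed
  qed (auto simp: M.a_ac)
  have "module complex_ring K"
    apply (rule moduleI[OF R.is_cring grp])
    subgoal by (auto intro!: imageI smult_in_carrier)
    subgoal using smult_l_distr by (auto simp: smult_in_carrier)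
    subgoal using smult_r_distr by (auto simp: smult_in_carrier)
    subgoal using smult_assoc1 by (auto simp: smult_in_carrier)
    subgoal using smult_one by auto
    done
  then show ?thesis
    apply (rule complex_inner_space.intro)
    apply (unfold_locales)
    subgoal by (auto simp: cip_add_left)
    subgoal by (auto simp: cip_smult_left smult_in_carrier)
    subgoal by clarsimp (rule cip_cnj)
    subgoal by (auto simp: cip_ge_zero)
    subgoal by (auto intro!: arg_cong[where f = f] cip_eq_zero)
    done
qed

interpretation K: complex_inner_space K by (rule inner_space_K)

lemma f_minus: "\<lbrakk>x \<in> carrier H; y \<in> carrier H\<rbrakk> \<Longrightarrow> f x \<ominus>\<^bsub>K\<^esub> f y = f (x \<ominus> y)"
  by (simp add: K.minus_eq_smult minus_eq_smult smult_in_carrier)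

lemma cnorm_f: "x \<in> carrier H \<Longrightarrow> cnorm K (f x) = cnorm H x"
  by (simp add: cnorm_def)

lemma cdist_f: "\<lbrakk>x \<in> carrier H; y \<in> carrier H\<rbrakk> \<Longrightarrow> cdist K (f x) (f y) = cdist H x y"
  by (simp add: cdist_def f_minus cnorm_f)

lemma hilbert_K:
  assumes "separable_hilbert_space H"
  shows "separable_hilbert_space K"
proof -
  interpret S: separable_hilbert_space H by fact
  interpret D: Metric_space12 "carrier H" "cdist H" "carrier K" "cdist K"
    by (simp add: Metric_space12_def Metric_space_cdist K.Metric_space_cdist del: K_simps)
  have hom: "homeomorphic_map D.M1.mtopology D.M2.mtopology f"
    by (rule D.isometry_imp_homeomorphic_map) (simp_all add: cdist_f)
  have sep: "separable_space D.M2.mtopology"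
    using S.separable homeomorphic_separable_space homeomorphic_map_imp_homeomorphic_space[OF hom]
    by blast
  have "\<exists>x. limitin D.M2.mtopology s x sequentially" if s: "D.M2.MCauchy s" for s
  proof -
    have "range s \<subseteq> carrier K" using s by (simp add: D.M2.MCauchy_def del: K_simps)
    then have "\<forall>n. \<exists>u\<in>carrier H. s n = f u" by auto
    then obtain t where t: "\<And>n. t n \<in> carrier H" "\<And>n. s n = f (t n)" by metis
    have "D.M1.MCauchy t"
    proof -
      have "\<forall>e>0. \<exists>N. \<forall>n n'. N \<le> n \<longrightarrow> N \<le> n' \<longrightarrow> cdist K (s n) (s n') < e"
        using s by (simp add: D.M2.MCauchy_def del: K_simps)
      then show ?thesis by (auto simp: D.M1.MCauchy_def t cdist_f)
    qed
    then obtain x where "limitin D.M1.mtopology t x sequentially"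
      using S.complete by (auto simp: D.M1.mcomplete_def)
    then have "limitin D.M2.mtopology s (f x) sequentially"
      unfolding D.M1.limit_metric_sequentially D.M2.limit_metric_sequentially
      using t by (auto simp: cdist_f)
    then show ?thesis ..
  qed
  then have "D.M2.mcomplete" by (simp add: D.M2.mcomplete_def del: K_simps)
  then show ?thesis
    using sep inner_space_K
    by (simp add: separable_hilbert_space_def separable_hilbert_space_axioms_def del: K_simps)
qed

definition conj_op :: "('a \<Rightarrow> 'a) \<Rightarrow> 'b \<Rightarrow> 'b" where
  "conj_op V y = f (V (inv_into (carrier H) f y))"

lemma conj_op_f: "x \<in> carrier H \<Longrightarrow> conj_op V (f x) = f (V x)"
  by (simp add: conj_op_def inv_into_f_f[OF inj])

lemma bij_conj_op:
  assumes "bij_betw V (carrier H) (carrier H)"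
  shows "bij_betw (conj_op V) (carrier K) (carrier K)"
  unfolding bij_betw_def
proof
  have V: "inj_on V (carrier H)" "V ` carrier H = carrier H"
    using assms by (auto simp: bij_betw_def)
  have Vc: "V x \<in> carrier H" if "x \<in> carrier H" for x using that V by auto
  show "inj_on (conj_op V) (carrier K)"
    using V(1) Vc by (auto simp: inj_on_def conj_op_f f_eq_iff)
  have "conj_op V ` carrier K = f ` V ` carrier H"
    by (simp add: image_image conj_op_f)
  then show "conj_op V ` carrier K = carrier K" using V by simp
qed

lemma funpow_conj_op:
  assumes "\<And>x. x \<in> carrier H \<Longrightarrow> V x \<in> carrier H"
    and "\<And>x. x \<in> carrier H \<Longrightarrow> W (f x) = f (V x)" and "x \<in> carrier H"
  shows "(V ^^ n) x \<in> carrier H \<and> (W ^^ n) (f x) = f ((V ^^ n) x)"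
  by (induction n) (use assms in auto)

lemma op_powi_conj_op:
  assumes V: "bij_betw V (carrier H) (carrier H)" and x: "x \<in> carrier H"
  shows "op_powi H V q x \<in> carrier H \<and> op_powi K (conj_op V) q (f x) = f (op_powi H V q x)"
proof -
  let ?I = "inv_into (carrier H) V"
  have Vc: "V x \<in> carrier H" if "x \<in> carrier H" for x
    using V that by (rule bij_betw_apply)
  have Ic: "?I x \<in> carrier H" if "x \<in> carrier H" for x
    using bij_betw_inv_into[OF V] that by (rule bij_betw_apply)
  have I: "inv_into (carrier K) (conj_op V) (f x) = f (?I x)" if x: "x \<in> carrier H" for x
  proof (rule inv_into_f_eq)
    show "inj_on (conj_op V) (carrier K)" using bij_conj_op[OF V] by (auto simp: bij_betw_def)
    show "f (?I x) \<in> carrier K" using Ic[OF x] by simp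
    show "conj_op V (f (?I x)) = f x"
      using Ic[OF x] bij_betw_inv_into_right[OF V x] by (simp add: conj_op_f)
  qed
  show ?thesis
    unfolding op_powi_def
    using funpow_conj_op[where V = V and W = "conj_op V", OF Vc conj_op_f x]
      funpow_conj_op[where V = ?I and W = "inv_into (carrier K) (conj_op V)", OF Ic I x]
    by (simp del: K_simps)
qed

lemma unitary_conj_op:
  assumes "unitary_operator H V"
  shows "unitary_operator K (conj_op V)"
proof -
  have V: "bij_betw V (carrier H) (carrier H)" using assms by (simp add: unitary_operator_def)
  have Vc: "V x \<in> carrier H" if "x \<in> carrier H" for x
    using V that by (rule bij_betw_apply)
  show ?thesis
    using assms bij_conj_op[OF V] Vc
    by (auto simp: unitary_operator_def conj_op_f smult_in_carrier)
qed

lemma eigenvalue_conj_op: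
  assumes V: "bij_betw V (carrier H) (carrier H)" and "is_eigenvalue K (conj_op V) a"
  shows "is_eigenvalue H V a"
proof -
  have Vc: "V x \<in> carrier H" if "x \<in> carrier H" for x
    using V that by (rule bij_betw_apply)
  show ?thesis
    using assms(2) Vc by (auto simp: is_eigenvalue_def conj_op_f f_eq_iff smult_in_carrier)
qed

lemma min_displacement_conj_op:
  assumes V: "bij_betw V (carrier H) (carrier H)"
  shows "min_displacement Q K (conj_op V) = min_displacement Q H V"
proof -
  have S: "{y \<in> carrier K. cnorm K y = 1} = f ` {x \<in> carrier H. cnorm H x = 1}"
    by (auto simp: cnorm_f)
  have "cnorm K (op_powi K (conj_op V) q (f x) \<ominus>\<^bsub>K\<^esub> f x) = cnorm H (op_powi H V q x \<ominus> x)"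
    if "x \<in> carrier H" for q x
    using op_powi_conj_op[OF V that, of q] that by (simp add: f_minus cnorm_f)
  then show ?thesis
    unfolding min_displacement_def S image_image by (auto intro!: INF_cong)
qed

end

theorem modified_kazhdan_le:
  fixes H :: "'a cip_space"
  assumes H: "separable_hilbert_space H" and V: "unitary_operator H V"
    and ev: "\<not> (\<exists>a. is_eigenvalue H V a)"
  shows "modified_kazhdan Q \<le> min_displacement Q H V"
proof -
  interpret S: separable_hilbert_space H by fact
  obtain f :: "'a \<Rightarrow> nat \<Rightarrow> complex" where f: "inj_on f (carrier H)"
    using S.inj_into_sequences by blast
  interpret transported H f by unfold_locales (rule f)
  have bij: "bij_betw V (carrier H) (carrier H)" using V by (simp add: unitary_operator_def)
  have "(K, conj_op V) \<in> {(H :: (nat \<Rightarrow> complex) cip_space, V).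
          separable_hilbert_space H \<and> unitary_operator H V \<and> \<not> (\<exists>a. is_eigenvalue H V a)}"
    using hilbert_K[OF H] unitary_conj_op[OF V] eigenvalue_conj_op[OF bij] ev by blast
  then have "modified_kazhdan Q \<le> min_displacement Q K (conj_op V)"
    unfolding modified_kazhdan_def by (rule INF_lower2) simp
  then show ?thesis by (simp add: min_displacement_conj_op[OF bij])
qed

end

theory Submission
  imports Defs
begin

text \<open>
  Let \<open>k\<^sub>i\<close> be the largest exponent of \<open>q = p\<^sub>1 ^ k\<^sub>1 \<cdots> p\<^sub>r ^ k\<^sub>r\<close>. Then \<open>p\<^sub>i ^ k\<^sub>i\<close> divides
  \<open>q\<close>, and \<open>q \<le> P ^ k\<^sub>i\<close> with \<open>P\<close> the product of the bases. For these \<open>q\<close>, the law of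
  \<open>exp (2 \<pi> i \<Sum>\<^sub>j \<xi>\<^sub>j p\<^sub>i ^ (-n\<^sub>j))\<close>, with independent \<open>\<xi>\<^sub>j \<in> {0, 1}\<close>,
  \<open>P(\<xi>\<^sub>j = 1) = 1/4\<close> and \<open>n\<^sub>j\<close> growing fast, has its coefficient of index \<open>q\<close> close to 1:
  the terms with \<open>n\<^sub>j \<le> k\<^sub>i\<close> contribute integers and all but the first of the others are
  negligible. Replacing each of the \<open>r\<close> measures by its convolution with its reflection makes
  all coefficients nonnegative, so their average has coefficients bounded below on all of \<open>E\<close>,
  by \<open>c > 0\<close> say. Multiplication by \<open>z\<close> on \<open>L\<^sup>2\<close> of this average is unitary without
  eigenvalues, and its powers in \<open>E\<close> displace the constant function 1 by at most \<open>sqrt (2 - 2 c)\<close>.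
\<close>

section \<open>The Hilbert space of square integrable functions\<close>

definition square_integrable :: "'a measure \<Rightarrow> ('a \<Rightarrow> complex) set" where
  "square_integrable M = {f \<in> borel_measurable M. integrable M (\<lambda>x. (cmod (f x))\<^sup>2)}"

text \<open>An element of \<open>L2 M\<close> is represented by the complex measure \<open>A \<mapsto> \<integral>\<^sub>A f dM\<close>, which determines
  \<open>f\<close> almost everywhere; this makes the module operations pointwise without forming a quotient.\<close>

definition set_charge :: "'a measure \<Rightarrow> ('a \<Rightarrow> complex) \<Rightarrow> 'a set \<Rightarrow> complex" where
  "set_charge M f A = (if A \<in> sets M then (LINT x:A|M. f x) else 0)"

text \<open>For \<open>u\<close> in the carrier a suitable \<open>f\<close> exists and is unique up
  to a null set, so integrals formed from the chosen representative do not depend on the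
  choice.\<close>

definition l2_rep :: "'a measure \<Rightarrow> ('a set \<Rightarrow> complex) \<Rightarrow> 'a \<Rightarrow> complex" where
  "l2_rep M u = (SOME f. f \<in> square_integrable M \<and> set_charge M f = u)"

definition L2 :: "'a measure \<Rightarrow> ('a set \<Rightarrow> complex) cip_space" where
  "L2 M = \<lparr>carrier = set_charge M ` square_integrable M,
     monoid.mult = (\<lambda>_ _. undefined), one = undefined,
     zero = (\<lambda>_. 0), add = (\<lambda>u v A. u A + v A), smult = (\<lambda>a u A. a * u A),
     cip = (\<lambda>u v. LINT x|M. l2_rep M u x * cnj (l2_rep M v x))\<rparr>"

section \<open>Closure properties of square integrable functions\<close>

lemma square_integrable_measurable: "f \<in> square_integrable M \<Longrightarrow> f \<in> borel_measurable M"
  and square_integrable_norm2: "f \<in> square_integrable M \<Longrightarrow> integrable M (\<lambda>x. (cmod (f x))\<^sup>2)"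
  by (auto simp: square_integrable_def)

lemma borel_measurable_cnj [measurable (raw)]:
  "f \<in> borel_measurable M \<Longrightarrow> (\<lambda>x. cnj (f x)) \<in> borel_measurable M"
  by (rule borel_measurable_continuous_on[OF continuous_on_cnj[OF continuous_on_id]])

lemma square_integrable_mult:
  assumes f: "f \<in> square_integrable M" and g: "g \<in> square_integrable M"
  shows "integrable M (\<lambda>x. f x * cnj (g x))"
proof (rule Bochner_Integration.integrable_bound)
  note [measurable] = f[THEN square_integrable_measurable] g[THEN square_integrable_measurable]
  show "integrable M (\<lambda>x. (cmod (f x))\<^sup>2 + (cmod (g x))\<^sup>2)"
    using f g by (simp add: square_integrable_norm2)
  show "(\<lambda>x. f x * cnj (g x)) \<in> borel_measurable M" by measurable
  have "a * b \<le> a\<^sup>2 + b\<^sup>2" if "a \<ge> 0" "b \<ge> 0" for a b :: real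
    using sum_squares_bound[of a b] mult_nonneg_nonneg[OF that] by linarith
  then show "AE x in M. norm (f x * cnj (g x)) \<le> norm ((cmod (f x))\<^sup>2 + (cmod (g x))\<^sup>2)"
    by (simp add: norm_mult)
qed

lemma square_integrable_scale:
  "f \<in> square_integrable M \<Longrightarrow> (\<lambda>x. a * f x) \<in> square_integrable M"
  by (auto simp: square_integrable_def norm_mult power_mult_distrib)

lemma square_integrable_bound:
  assumes "f \<in> borel_measurable M" and g: "integrable M g"
    and "AE x in M. (cmod (f x))\<^sup>2 \<le> g x"
  shows "f \<in> square_integrable M"
  unfolding square_integrable_def
proof (safe intro!: assms(1))
  note [measurable] = assms(1)
  show "integrable M (\<lambda>x. (cmod (f x))\<^sup>2)"
    by (rule Bochner_Integration.integrable_bound[OF g]) (use assms(3) in auto)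
qed

lemma norm_add_square_le: "(cmod (a + b))\<^sup>2 \<le> 2 * (cmod a)\<^sup>2 + 2 * (cmod b)\<^sup>2"
proof -
  have "(cmod (a + b))\<^sup>2 \<le> (cmod a + cmod b)\<^sup>2"
    by (simp add: power_mono norm_triangle_ineq)
  also have "\<dots> \<le> 2 * (cmod a)\<^sup>2 + 2 * (cmod b)\<^sup>2"
    using sum_squares_bound[of "cmod a" "cmod b"] by (simp add: power2_sum)
  finally show ?thesis .
qed

lemma square_integrable_add:
  assumes f: "f \<in> square_integrable M" and g: "g \<in> square_integrable M"
  shows "(\<lambda>x. f x + g x) \<in> square_integrable M"
proof (rule square_integrable_bound)
  show "integrable M (\<lambda>x. 2 * (cmod (f x))\<^sup>2 + 2 * (cmod (g x))\<^sup>2)"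
    using f g by (simp add: square_integrable_norm2)
  show "(\<lambda>x. f x + g x) \<in> borel_measurable M"
    using f g by (auto dest!: square_integrable_measurable)
qed (simp add: norm_add_square_le)

lemma square_integrable_diff:
  assumes "f \<in> square_integrable M" and "g \<in> square_integrable M"
  shows "(\<lambda>x. f x - g x) \<in> square_integrable M"
  using square_integrable_add[OF assms(1) square_integrable_scale[OF assms(2), of "-1"]] by simp

lemma square_integrable_mult_bounded:
  assumes "f \<in> square_integrable M" "z \<in> borel_measurable M" "\<And>x. x \<in> space M \<Longrightarrow> cmod (z x) \<le> 1"
  shows "(\<lambda>x. z x * f x) \<in> square_integrable M"
proof (rule square_integrable_bound)
  show "(\<lambda>x. z x * f x) \<in> borel_measurable M"
    using assms by (auto dest!: square_integrable_measurable)
  show "AE x in M. (cmod (z x * f x))\<^sup>2 \<le> (cmod (f x))\<^sup>2"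
    using assms(3) by (auto intro!: AE_I2 power_mono simp: norm_mult mult_left_le_one_le)
qed (use assms in \<open>simp add: square_integrable_norm2\<close>)

lemma (in finite_measure) square_integrable_bounded:
  assumes "f \<in> borel_measurable M" "\<And>x. x \<in> space M \<Longrightarrow> cmod (f x) \<le> B"
  shows "f \<in> square_integrable M"
  by (rule square_integrable_bound[where g = "\<lambda>_. B\<^sup>2"]) (use assms in \<open>auto intro!: power_mono\<close>)

text \<open>Pair \<open>f\<close> with the constant 1, which is square integrable because the
  measure is finite.\<close>

lemma (in finite_measure) square_integrable_integrable:
  "f \<in> square_integrable M \<Longrightarrow> integrable M f"
  using square_integrable_mult[of f M "\<lambda>_. 1"] square_integrable_bounded[of "\<lambda>_. 1" 1] by simp

section \<open>The inner product structure of \<open>L2 M\<close>\<close>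

context finite_measure
begin

text \<open>Integrals over all measurable sets determine a function almost everywhere, by uniqueness
  of densities. Hence charges are a faithful substitute for almost everywhere classes.\<close>

lemma set_charge_eq_iff:
  assumes f: "f \<in> square_integrable M" and g: "g \<in> square_integrable M"
  shows "set_charge M f = set_charge M g \<longleftrightarrow> (AE x in M. f x = g x)"
proof
  assume eq: "set_charge M f = set_charge M g"
  have "(LINT x:A|M. f x) = (LINT x:A|M. g x)" if "A \<in> sets M" for A
    using fun_cong[OF eq, of A] that by (simp add: set_charge_def)
  then show "AE x in M. f x = g x"
    using f g by (intro density_unique_banach) (auto intro: square_integrable_integrable)
next
  assume ae: "AE x in M. f x = g x"
  note [measurable] = f[THEN square_integrable_measurable] g[THEN square_integrable_measurable]
  have "(LINT x:A|M. f x) = (LINT x:A|M. g x)" if [measurable]: "A \<in> sets M" for A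
    unfolding set_lebesgue_integral_def by (rule integral_cong_AE) (use ae in auto)
  then show "set_charge M f = set_charge M g"
    by (auto simp: set_charge_def fun_eq_iff)
qed

lemma l2_rep_set_charge:
  assumes "f \<in> square_integrable M"
  shows "l2_rep M (set_charge M f) \<in> square_integrable M"
    and "AE x in M. l2_rep M (set_charge M f) x = f x"
proof -
  let ?g = "l2_rep M (set_charge M f)"
  have *: "?g \<in> square_integrable M \<and> set_charge M ?g = set_charge M f"
    unfolding l2_rep_def by (rule someI[where x = f]) (use assms in simp)
  then show "?g \<in> square_integrable M" by simp
  show "AE x in M. ?g x = f x"
    using * set_charge_eq_iff[of ?g f] assms by simp
qed

text \<open>Any representatives may be used, since those picked by \<open>l2_rep\<close> differ from
  them only on null sets.\<close>

lemma cip_L2: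
  assumes f: "f \<in> square_integrable M" and g: "g \<in> square_integrable M"
  shows "cip (L2 M) (set_charge M f) (set_charge M g) = (LINT x|M. f x * cnj (g x))"
proof -
  note [measurable] = f[THEN square_integrable_measurable] g[THEN square_integrable_measurable]
    l2_rep_set_charge(1)[OF f, THEN square_integrable_measurable]
    l2_rep_set_charge(1)[OF g, THEN square_integrable_measurable]
  have "(LINT x|M. l2_rep M (set_charge M f) x * cnj (l2_rep M (set_charge M g) x)) =
      (LINT x|M. f x * cnj (g x))"
    by (rule integral_cong_AE) (use l2_rep_set_charge(2)[OF f] l2_rep_set_charge(2)[OF g] in auto)
  then show ?thesis by (simp add: L2_def)
qed

lemma L2_add:
  assumes "f \<in> square_integrable M" "g \<in> square_integrable M"
  shows "set_charge M f \<oplus>\<^bsub>L2 M\<^esub> set_charge M g = set_charge M (\<lambda>x. f x + g x)"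
proof -
  have "(LINT x:A|M. f x + g x) = (LINT x:A|M. f x) + (LINT x:A|M. g x)" if "A \<in> sets M" for A
    using assms that
    by (intro set_integral_add(2))
      (auto intro!: integrable_mult_indicator intro: square_integrable_integrable simp: set_integrable_def)
  then show ?thesis by (simp add: L2_def set_charge_def fun_eq_iff)
qed

lemma L2_smult: "a \<odot>\<^bsub>L2 M\<^esub> set_charge M f = set_charge M (\<lambda>x. a * f x)"
  by (simp add: L2_def set_charge_def fun_eq_iff)

lemma L2_zero: "\<zero>\<^bsub>L2 M\<^esub> = set_charge M (\<lambda>x. 0)"
  by (simp add: L2_def set_charge_def fun_eq_iff set_lebesgue_integral_def)

lemma carrier_L2: "carrier (L2 M) = set_charge M ` square_integrable M"
  by (simp add: L2_def)

lemma square_integrable_zero: "(\<lambda>x. 0) \<in> square_integrable M"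
  by (simp add: square_integrable_def)

lemma cip_L2_self:
  assumes "f \<in> square_integrable M"
  shows "cip (L2 M) (set_charge M f) (set_charge M f) = of_real (LINT x|M. (cmod (f x))\<^sup>2)"
proof -
  have "(LINT x|M. f x * cnj (f x)) = (LINT x|M. complex_of_real ((cmod (f x))\<^sup>2))"
    by (simp only: complex_norm_square)
  then show ?thesis using assms by (simp add: cip_L2 del: of_real_power)
qed

text \<open>Addition and scaling are pointwise on charges, so most module laws reduce to those of
  the complex numbers. Definiteness is a genuine equality: a function of norm zero vanishes almost
  everywhere, so its charge is that of the zero function.\<close>

lemma complex_inner_space_L2: "complex_inner_space (L2 M)"
proof -
  note cl = square_integrable_add square_integrable_scale
  have cring: "cring complex_ring"
  proof (rule cringI)
    show "abelian_group complex_ring"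
      by (rule abelian_groupI) (auto simp: complex_ring_def algebra_simps intro: exI[of _ "- _"])
    show "comm_monoid complex_ring"
      by (rule comm_monoidI) (auto simp: complex_ring_def)
  qed (auto simp: complex_ring_def algebra_simps)
  have grp: "abelian_group (L2 M)"
  proof (rule abelian_groupI)
    show "\<exists>v\<in>carrier (L2 M). v \<oplus>\<^bsub>L2 M\<^esub> u = \<zero>\<^bsub>L2 M\<^esub>" if "u \<in> carrier (L2 M)" for u
    proof -
      from that obtain f where f: "f \<in> square_integrable M" "u = set_charge M f"
        by (auto simp: carrier_L2)
      have "set_charge M (\<lambda>x. - 1 * f x) \<oplus>\<^bsub>L2 M\<^esub> u = \<zero>\<^bsub>L2 M\<^esub>"
        unfolding f(2) L2_add[OF square_integrable_scale[OF f(1)] f(1)] L2_zero by simp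
      then show ?thesis using square_integrable_scale[OF f(1)] unfolding carrier_L2 by blast
    qed
    show "u \<oplus>\<^bsub>L2 M\<^esub> v \<in> carrier (L2 M)" if "u \<in> carrier (L2 M)" "v \<in> carrier (L2 M)" for u v
      using that by (auto simp: carrier_L2 L2_add cl)
    show "\<zero>\<^bsub>L2 M\<^esub> \<in> carrier (L2 M)"
      by (simp add: carrier_L2 L2_zero square_integrable_zero)
  qed (auto simp: L2_def algebra_simps)
  have "module complex_ring (L2 M)"
  proof (rule moduleI[OF cring grp])
    show "a \<odot>\<^bsub>L2 M\<^esub> u \<in> carrier (L2 M)" if "u \<in> carrier (L2 M)" for a u
      using that by (auto simp: carrier_L2 L2_smult cl)
  qed (auto simp: L2_def complex_ring_def algebra_simps)
  moreover have "complex_inner_space_axioms (L2 M)"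
  proof
    fix u v w a
    assume u: "u \<in> carrier (L2 M)"
    then obtain f where f: "f \<in> square_integrable M" "u = set_charge M f"
      by (auto simp: carrier_L2)
    show "0 \<le> Re (cip (L2 M) u u)" using f by (simp add: cip_L2_self)
    show "u = \<zero>\<^bsub>L2 M\<^esub>" if "cip (L2 M) u u = 0"
    proof -
      have "(LINT x|M. (cmod (f x))\<^sup>2) = 0" using that f by (simp add: cip_L2_self)
      then have "AE x in M. f x = 0"
        using integral_nonneg_eq_0_iff_AE[OF square_integrable_norm2[OF f(1)]] by simp
      then show ?thesis
        using f set_charge_eq_iff[OF f(1) square_integrable_zero] by (simp add: L2_zero)
    qed
    assume v: "v \<in> carrier (L2 M)"
    then obtain g where g: "g \<in> square_integrable M" "v = set_charge M g"
      by (auto simp: carrier_L2)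
    show "cip (L2 M) (a \<odot>\<^bsub>L2 M\<^esub> u) v = a * cip (L2 M) u v"
      using f g by (simp add: cip_L2 L2_smult cl mult.assoc)
    show "cip (L2 M) v u = cnj (cip (L2 M) u v)"
    proof -
      have "cnj (LINT x|M. f x * cnj (g x)) = (LINT x|M. cnj (f x * cnj (g x)))"
        by (rule Bochner_Integration.integral_cnj[symmetric])
      also have "\<dots> = (LINT x|M. g x * cnj (f x))" by (simp only: complex_cnj_mult complex_cnj_cnj mult.commute)
      finally show ?thesis using f g by (simp add: cip_L2)
    qed
    assume w: "w \<in> carrier (L2 M)"
    then obtain h where h: "h \<in> square_integrable M" "w = set_charge M h"
      by (auto simp: carrier_L2)
    show "cip (L2 M) (u \<oplus>\<^bsub>L2 M\<^esub> v) w = cip (L2 M) u w + cip (L2 M) v w"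
      using f g h by (simp add: cip_L2 L2_add cl square_integrable_mult distrib_right)
  qed
  ultimately show ?thesis by (rule complex_inner_space.intro)
qed

end

section \<open>Norm, distance and completeness of \<open>L2 M\<close>\<close>

context finite_measure
begin

lemma cnorm_L2:
  "f \<in> square_integrable M \<Longrightarrow> cnorm (L2 M) (set_charge M f) = sqrt (LINT x|M. (cmod (f x))\<^sup>2)"
  by (simp add: cnorm_def cip_L2_self)

lemma L2_minus:
  assumes f: "f \<in> square_integrable M" and g: "g \<in> square_integrable M"
  shows "set_charge M f \<ominus>\<^bsub>L2 M\<^esub> set_charge M g = set_charge M (\<lambda>x. f x - g x)"
proof -
  interpret L: complex_inner_space "L2 M" by (rule complex_inner_space_L2)
  show ?thesis
    using f g L2_add[OF f square_integrable_scale[OF g, of "- 1"]]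
    by (subst L.minus_eq_smult) (auto simp: carrier_L2 L2_smult)
qed

lemma cdist_L2:
  assumes "f \<in> square_integrable M" "g \<in> square_integrable M"
  shows "cdist (L2 M) (set_charge M f) (set_charge M g) = sqrt (LINT x|M. (cmod (f x - g x))\<^sup>2)"
  using assms by (simp add: cdist_def L2_minus cnorm_L2 square_integrable_diff carrier_L2)

text \<open>Cauchy-Schwarz for \<open>cmod (f x)\<close> and the constant 1. It turns an L2 Cauchy
  sequence into an L1 Cauchy sequence, which has an almost everywhere convergent
  subsequence.\<close>

lemma integral_norm_le_L2:
  assumes f: "f \<in> square_integrable M"
  shows "(LINT x|M. cmod (f x)) \<le> sqrt (LINT x|M. (cmod (f x))\<^sup>2) * sqrt (measure M (space M))"
proof -
  interpret L: complex_inner_space "L2 M" by (rule complex_inner_space_L2)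
  let ?g = "\<lambda>x. complex_of_real (cmod (f x))"
  note [measurable] = f[THEN square_integrable_measurable]
  have g: "?g \<in> square_integrable M"
    by (rule square_integrable_bound[OF _ square_integrable_norm2[OF f]]) (auto)
  have one: "(\<lambda>_. 1) \<in> square_integrable M"
    by (rule square_integrable_bounded[of _ 1]) auto
  have "cmod (cip (L2 M) (set_charge M ?g) (set_charge M (\<lambda>_. 1)))
      \<le> cnorm (L2 M) (set_charge M ?g) * cnorm (L2 M) (set_charge M (\<lambda>_. 1))"
    using g one by (intro L.Cauchy_Schwarz) (auto simp: carrier_L2)
  then show ?thesis using g one by (simp add: cip_L2 cnorm_L2)
qed

end

text \<open>Fatou's lemma for the squared norms: it shows at once that the limit is square
  integrable and that it inherits the bound.\<close>

lemma square_integrable_Fatou: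
  assumes g: "\<And>i. g i \<in> square_integrable M" and [measurable]: "G \<in> borel_measurable M"
    and lim: "AE x in M. (\<lambda>i. g i x) \<longlonglongrightarrow> G x"
    and bound: "\<forall>\<^sub>F i in sequentially. (LINT x|M. (cmod (g i x))\<^sup>2) \<le> B"
  shows "G \<in> square_integrable M" and "(LINT x|M. (cmod (G x))\<^sup>2) \<le> B"
proof -
  note [measurable] = g[THEN square_integrable_measurable]
  \<comment> \<open>\<open>ennreal\<close> sends negative reals to 0, so the final bound in
    \<open>ennreal\<close> yields a real inequality only for nonnegative \<open>B\<close>.\<close>
  have B: "B \<ge> 0"
  proof -
    obtain i where i: "(LINT x|M. (cmod (g i x))\<^sup>2) \<le> B"
      using bound by (auto simp: eventually_sequentially)
    have "0 \<le> (LINT x|M. (cmod (g i x))\<^sup>2)" by simp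
    then show ?thesis using i by linarith
  qed
  have "(\<integral>\<^sup>+x. ennreal ((cmod (G x))\<^sup>2) \<partial>M) =
      (\<integral>\<^sup>+x. liminf (\<lambda>i. ennreal ((cmod (g i x))\<^sup>2)) \<partial>M)"
  proof (rule nn_integral_cong_AE)
    show "AE x in M. ennreal ((cmod (G x))\<^sup>2) = liminf (\<lambda>i. ennreal ((cmod (g i x))\<^sup>2))"
      using lim
    proof eventually_elim
      case (elim x)
      have "(\<lambda>i. ennreal ((cmod (g i x))\<^sup>2)) \<longlonglongrightarrow> ennreal ((cmod (G x))\<^sup>2)"
        by (intro tendsto_ennrealI tendsto_intros elim)
      then show ?case using lim_imp_Liminf[OF sequentially_bot] by metis
    qed
  qed
  also have "\<dots> \<le> liminf (\<lambda>i. \<integral>\<^sup>+x. ennreal ((cmod (g i x))\<^sup>2) \<partial>M)"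
    by (rule nn_integral_liminf) simp
  also have "\<dots> = liminf (\<lambda>i. ennreal (LINT x|M. (cmod (g i x))\<^sup>2))"
    using g by (simp add: nn_integral_eq_integral square_integrable_norm2)
  also have "\<dots> \<le> ennreal B"
  proof -
    have "liminf (\<lambda>i. ennreal (LINT x|M. (cmod (g i x))\<^sup>2)) \<le> liminf (\<lambda>i. ennreal B)"
      by (rule Liminf_mono) (use bound in eventually_elim, simp add: ennreal_leI)
    then show ?thesis by (simp add: Liminf_const)
  qed
  finally have *: "(\<integral>\<^sup>+x. ennreal ((cmod (G x))\<^sup>2) \<partial>M) \<le> ennreal B" .
  have int: "integrable M (\<lambda>x. (cmod (G x))\<^sup>2)"
    by (rule integrableI_bounded) (use * in \<open>auto simp: le_less_trans[OF _ ennreal_less_top]\<close>)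
  then show "G \<in> square_integrable M" by (simp add: square_integrable_def)
  show "(LINT x|M. (cmod (G x))\<^sup>2) \<le> B"
    using * int B by (simp add: nn_integral_eq_integral)
qed

text \<open>Riesz-Fischer: an L2 Cauchy sequence is L1 Cauchy, so a subsequence converges almost
  everywhere, and Fatou along it identifies its limit as the L2 limit of the whole sequence.\<close>

lemma (in finite_measure) mcomplete_L2:
  "Metric_space.mcomplete (carrier (L2 M)) (cdist (L2 M))"
proof -
  interpret L: complex_inner_space "L2 M" by (rule complex_inner_space_L2)
  interpret D: Metric_space "carrier (L2 M)" "cdist (L2 M)" by (rule L.Metric_space_cdist)
  have "\<exists>u. limitin D.mtopology s u sequentially" if s: "D.MCauchy s" for s
  proof -
    have "range s \<subseteq> carrier (L2 M)" using s by (simp add: D.MCauchy_def)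
    then have "\<exists>f. f \<in> square_integrable M \<and> s n = set_charge M f" for n
      by (auto simp: carrier_L2)
    then obtain f where f: "\<And>n. f n \<in> square_integrable M" "\<And>n. s n = set_charge M (f n)"
      by metis
    define d where "d m n = sqrt (LINT x|M. (cmod (f m x - f n x))\<^sup>2)" for m n
    have d_cauchy: "\<exists>N. \<forall>m\<ge>N. \<forall>n\<ge>N. d m n < e" if "e > 0" for e
    proof -
      have "\<exists>N. \<forall>m n. N \<le> m \<longrightarrow> N \<le> n \<longrightarrow> cdist (L2 M) (s m) (s n) < e"
        using s that by (simp add: D.MCauchy_def)
      then show ?thesis by (auto simp: f cdist_L2 d_def)
    qed
    note [measurable] = f(1)[THEN square_integrable_measurable]
    \<comment> \<open>Adding 1 keeps \<open>K\<close> positive even for the zero measure.\<close>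
    define K where "K = sqrt (measure M (space M)) + 1"
    have K: "K > 0" by (simp add: K_def add_nonneg_pos)
    have "\<exists>N. \<forall>i\<ge>N. \<forall>j\<ge>N. (LINT x|M. cmod (f i x - f j x)) < e" if "e > 0" for e
    proof -
      obtain N where N: "\<And>m n. m \<ge> N \<Longrightarrow> n \<ge> N \<Longrightarrow> d m n < e / K"
        using d_cauchy[of "e / K"] \<open>e > 0\<close> K by auto
      have "(LINT x|M. cmod (f i x - f j x)) < e" if "i \<ge> N" "j \<ge> N" for i j
      proof -
        have d: "0 \<le> d i j" by (simp add: d_def)
        have "(LINT x|M. cmod (f i x - f j x)) \<le> d i j * sqrt (measure M (space M))"
          unfolding d_def by (intro integral_norm_le_L2 square_integrable_diff f)
        also have "\<dots> \<le> d i j * K" by (rule mult_left_mono[OF _ d]) (simp add: K_def)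
        also have "\<dots> < e" using N[OF that] K by (simp add: field_simps)
        finally show ?thesis .
      qed
      then show ?thesis by blast
    qed
    then obtain r where r: "strict_mono r" "AE x in M. Cauchy (\<lambda>i. f (r i) x)"
      using cauchy_L1_AE_cauchy_subseq[of M f, OF square_integrable_integrable[OF f(1)]] by metis
    \<comment> \<open>Off the convergence set \<open>lim\<close> is unspecified; this affects only a
      null set, and \<open>F\<close> is still measurable.\<close>
    define F where "F x = lim (\<lambda>i. f (r i) x)" for x
    have [measurable]: "F \<in> borel_measurable M" unfolding F_def by measurable
    have lim: "AE x in M. (\<lambda>i. f (r i) x) \<longlonglongrightarrow> F x"
      using r(2) by eventually_elim (simp add: F_def Cauchy_convergent_iff convergent_LIMSEQ_iff)
    \<comment> \<open>Fix \<open>n\<close> and let \<open>i\<close> tend to infinity in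
      \<open>d (r i) n < e\<close>: Fatou carries the bound over to \<open>F\<close>.\<close>
    have Fn: "(\<lambda>x. F x - f n x) \<in> square_integrable M \<and> (LINT x|M. (cmod (F x - f n x))\<^sup>2) \<le> e\<^sup>2"
      if N: "\<And>m n. m \<ge> N \<Longrightarrow> n \<ge> N \<Longrightarrow> d m n < e" and n: "n \<ge> N" for e N n
    proof -
      have ae: "AE x in M. (\<lambda>i. f (r i) x - f n x) \<longlonglongrightarrow> F x - f n x"
        using lim by eventually_elim (intro tendsto_intros)
      have "\<forall>\<^sub>F i in sequentially. (LINT x|M. (cmod (f (r i) x - f n x))\<^sup>2) \<le> e\<^sup>2"
        using eventually_ge_at_top[of N]
      proof eventually_elim
        case (elim i)
        then have "d (r i) n < e" using seq_suble[OF r(1), of i] by (intro N n) simp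
        then have "(d (r i) n)\<^sup>2 \<le> e\<^sup>2" by (intro power_mono) (auto simp: d_def)
        then show ?case by (simp add: d_def)
      qed
      moreover have "(\<lambda>x. f (r i) x - f n x) \<in> square_integrable M" for i
        by (intro square_integrable_diff f)
      moreover have "(\<lambda>x. F x - f n x) \<in> borel_measurable M" by measurable
      ultimately show ?thesis
        using square_integrable_Fatou[where g = "\<lambda>i x. f (r i) x - f n x" and G = "\<lambda>x. F x - f n x", OF _ _ ae]
        by blast
    qed
    \<comment> \<open>One square integrable difference suffices: adding \<open>f N1\<close> back
      shows that \<open>F\<close> itself is square integrable.\<close>
    obtain N1 where "\<And>m n. m \<ge> N1 \<Longrightarrow> n \<ge> N1 \<Longrightarrow> d m n < 1"
      using d_cauchy[of 1] by auto
    then have "(\<lambda>x. F x - f N1 x) \<in> square_integrable M" using Fn by blast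
    from square_integrable_add[OF this f(1)[of N1]] have F: "F \<in> square_integrable M" by simp
    have "\<exists>N. \<forall>n\<ge>N. cdist (L2 M) (s n) (set_charge M F) < e" if "e > 0" for e
    proof -
      \<comment> \<open>\<open>e / 2\<close> because the limit preserves only the weak
        inequality.\<close>
      obtain N where N: "\<And>m n. m \<ge> N \<Longrightarrow> n \<ge> N \<Longrightarrow> d m n < e / 2"
        using d_cauchy[of "e / 2"] \<open>e > 0\<close> by auto
      have "cdist (L2 M) (s n) (set_charge M F) < e" if "n \<ge> N" for n
      proof -
        have "sqrt (LINT x|M. (cmod (F x - f n x))\<^sup>2) \<le> e / 2"
          using Fn[OF N that] \<open>e > 0\<close> by (intro real_le_lsqrt) auto
        then show ?thesis using f F \<open>e > 0\<close> by (simp add: cdist_L2 norm_minus_commute)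
      qed
      then show ?thesis by blast
    qed
    moreover have "set_charge M F \<in> carrier (L2 M)" "\<And>n. s n \<in> carrier (L2 M)"
      using F f by (auto simp: carrier_L2)
    ultimately have "limitin D.mtopology s (set_charge M F) sequentially"
      by (simp add: D.limit_metric_sequentially)
    then show ?thesis by blast
  qed
  then show ?thesis by (simp add: D.mcomplete_def)
qed

section \<open>Separability of \<open>L2 M\<close>\<close>

context finite_measure
begin

text \<open>Dominated convergence: \<open>cmod (f x - s i x) \<le> 3 * cmod (f x)\<close>, hence the
  factor 9 in the majorant. The factor 2 in the hypothesis is the one that comes with approximation
  by simple functions.\<close>

lemma L2_approx_dominated:
  assumes s: "\<And>i. s i \<in> square_integrable M" and f: "f \<in> square_integrable M"
    and lim: "\<And>x. x \<in> space M \<Longrightarrow> (\<lambda>i. s i x) \<longlonglongrightarrow> f x"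
    and bound: "\<And>i x. x \<in> space M \<Longrightarrow> cmod (s i x) \<le> 2 * cmod (f x)"
  shows "(\<lambda>i. LINT x|M. (cmod (f x - s i x))\<^sup>2) \<longlonglongrightarrow> 0"
proof -
  note [measurable] = f[THEN square_integrable_measurable] s[THEN square_integrable_measurable]
  have "(\<lambda>i. LINT x|M. (cmod (f x - s i x))\<^sup>2) \<longlonglongrightarrow> (LINT x|M. 0)"
  proof (rule integral_dominated_convergence)
    show "integrable M (\<lambda>x. 9 * (cmod (f x))\<^sup>2)"
      using f by (simp add: square_integrable_norm2)
    show "AE x in M. (\<lambda>i. (cmod (f x - s i x))\<^sup>2) \<longlonglongrightarrow> 0"
    proof (rule AE_I2)
      fix x assume "x \<in> space M"
      then have "(\<lambda>i. (cmod (f x - s i x))\<^sup>2) \<longlonglongrightarrow> (cmod (f x - f x))\<^sup>2"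
        by (intro tendsto_intros lim)
      then show "(\<lambda>i. (cmod (f x - s i x))\<^sup>2) \<longlonglongrightarrow> 0" by simp
    qed
    show "AE x in M. norm ((cmod (f x - s i x))\<^sup>2) \<le> 9 * (cmod (f x))\<^sup>2" for i
    proof (rule AE_I2)
      fix x assume "x \<in> space M"
      then have "cmod (f x - s i x) \<le> 3 * cmod (f x)"
        using norm_triangle_ineq4[of "f x" "s i x"] bound[of x i] by linarith
      then have "(cmod (f x - s i x))\<^sup>2 \<le> (3 * cmod (f x))\<^sup>2" by (intro power_mono) auto
      then show "norm ((cmod (f x - s i x))\<^sup>2) \<le> 9 * (cmod (f x))\<^sup>2" by simp
    qed
  qed auto
  then show ?thesis by simp
qed

text \<open>Closure for the L2 seminorm on functions, so that density can be proved before passing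
  to charges. Distances stay squared.\<close>

definition L2_closure :: "('a \<Rightarrow> complex) set \<Rightarrow> ('a \<Rightarrow> complex) set" where
  "L2_closure C = {f \<in> square_integrable M. \<forall>e>0. \<exists>g\<in>C. (LINT x|M. (cmod (f x - g x))\<^sup>2) < e}"

lemma L2_closureD:
  "f \<in> L2_closure C \<Longrightarrow> e > 0 \<Longrightarrow> \<exists>g\<in>C. (LINT x|M. (cmod (f x - g x))\<^sup>2) < e"
  by (auto simp: L2_closure_def)

text \<open>Closure is idempotent. Squared distances obey the triangle inequality only up to a
  factor 2 (\<open>norm_add_square_le\<close>), so each of the two errors is kept below
  \<open>e / 4\<close>.\<close>

lemma L2_closureI:
  assumes C: "C \<subseteq> square_integrable M" and f: "f \<in> square_integrable M"
    and "\<And>e. e > 0 \<Longrightarrow> \<exists>g\<in>L2_closure C. (LINT x|M. (cmod (f x - g x))\<^sup>2) < e"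
  shows "f \<in> L2_closure C"
  unfolding L2_closure_def
proof (safe intro!: f)
  fix e :: real assume "e > 0"
  then obtain g where g: "g \<in> L2_closure C" "(LINT x|M. (cmod (f x - g x))\<^sup>2) < e / 4"
    using assms(3)[of "e / 4"] by auto
  then obtain h where h: "h \<in> C" "(LINT x|M. (cmod (g x - h x))\<^sup>2) < e / 4"
    using L2_closureD[OF g(1), of "e / 4"] \<open>e > 0\<close> by auto
  have gs: "g \<in> square_integrable M" "h \<in> square_integrable M"
    using g h C by (auto simp: L2_closure_def)
  note int = square_integrable_norm2[OF square_integrable_diff]
  have "(LINT x|M. (cmod (f x - h x))\<^sup>2) \<le>
      (LINT x|M. 2 * (cmod (f x - g x))\<^sup>2 + 2 * (cmod (g x - h x))\<^sup>2)"
  proof (rule integral_mono)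
    show "(cmod (f x - h x))\<^sup>2 \<le> 2 * (cmod (f x - g x))\<^sup>2 + 2 * (cmod (g x - h x))\<^sup>2" for x
      using norm_add_square_le[of "f x - g x" "g x - h x"] by simp
  qed (intro Bochner_Integration.integrable_add integrable_mult_right int f gs)+
  also have "\<dots> = 2 * (LINT x|M. (cmod (f x - g x))\<^sup>2) + 2 * (LINT x|M. (cmod (g x - h x))\<^sup>2)"
    by (simp add: int f gs)
  also have "\<dots> < e" using g h by simp
  finally show "\<exists>h\<in>C. (LINT x|M. (cmod (f x - h x))\<^sup>2) < e" using h by blast
qed

lemma L2_closure_add:
  assumes C: "C \<subseteq> square_integrable M" "\<And>f g. f \<in> C \<Longrightarrow> g \<in> C \<Longrightarrow> (\<lambda>x. f x + g x) \<in> C"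
    and f: "f \<in> L2_closure C" and g: "g \<in> L2_closure C"
  shows "(\<lambda>x. f x + g x) \<in> L2_closure C"
proof -
  have fs: "f \<in> square_integrable M" and gs: "g \<in> square_integrable M"
    using f g by (auto simp: L2_closure_def)
  show ?thesis
    unfolding L2_closure_def
  proof (safe intro!: square_integrable_add fs gs)
    fix e :: real assume "e > 0"
    then obtain f' g' where f': "f' \<in> C" "(LINT x|M. (cmod (f x - f' x))\<^sup>2) < e / 4"
      and g': "g' \<in> C" "(LINT x|M. (cmod (g x - g' x))\<^sup>2) < e / 4"
      using L2_closureD[OF f, of "e / 4"] L2_closureD[OF g, of "e / 4"] by auto
    have s: "f' \<in> square_integrable M" "g' \<in> square_integrable M" using f' g' C by auto
    note int = square_integrable_norm2[OF square_integrable_diff]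
    have "(LINT x|M. (cmod (f x + g x - (f' x + g' x)))\<^sup>2) \<le>
        (LINT x|M. 2 * (cmod (f x - f' x))\<^sup>2 + 2 * (cmod (g x - g' x))\<^sup>2)"
    proof (rule integral_mono)
      show "(cmod (f x + g x - (f' x + g' x)))\<^sup>2 \<le> 2 * (cmod (f x - f' x))\<^sup>2 + 2 * (cmod (g x - g' x))\<^sup>2" for x
        using norm_add_square_le[of "f x - f' x" "g x - g' x"] by (simp add: algebra_simps)
    qed (intro Bochner_Integration.integrable_add integrable_mult_right int square_integrable_add fs gs s)+
    also have "\<dots> = 2 * (LINT x|M. (cmod (f x - f' x))\<^sup>2) + 2 * (LINT x|M. (cmod (g x - g' x))\<^sup>2)"
      by (simp add: int fs gs s)
    also have "\<dots> < e" using f' g' by simp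
    finally show "\<exists>h\<in>C. (LINT x|M. (cmod (f x + g x - h x))\<^sup>2) < e"
      using C(2)[OF f'(1) g'(1)] by (intro bexI[of _ "\<lambda>x. f' x + g' x"])
  qed
qed

lemma L2_closure_dominated:
  assumes C: "C \<subseteq> square_integrable M"
    and s: "\<And>i. s i \<in> L2_closure C" and f: "f \<in> square_integrable M"
    and "\<And>x. x \<in> space M \<Longrightarrow> (\<lambda>i. s i x) \<longlonglongrightarrow> f x"
    and "\<And>i x. x \<in> space M \<Longrightarrow> cmod (s i x) \<le> 2 * cmod (f x)"
  shows "f \<in> L2_closure C"
proof (rule L2_closureI[OF C f])
  fix e :: real assume "e > 0"
  have "(\<lambda>i. LINT x|M. (cmod (f x - s i x))\<^sup>2) \<longlonglongrightarrow> 0"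
    by (rule L2_approx_dominated) (use assms in \<open>auto simp: L2_closure_def\<close>)
  then have "\<forall>\<^sub>F i in sequentially. (LINT x|M. (cmod (f x - s i x))\<^sup>2) < e"
    using \<open>e > 0\<close> by (rule order_tendstoD)
  then show "\<exists>g\<in>L2_closure C. (LINT x|M. (cmod (f x - g x))\<^sup>2) < e"
    using s by (auto simp: eventually_sequentially)
qed

text \<open>\<open>C\<close> consists of finite sums of indicators of generating sets with
  coefficients in a countable dense set. A Dynkin system argument extends approximability from the
  generator to all measurable sets; simple functions then reach everything.\<close>

lemma L2_countable_dense:
  assumes A: "countable A" "Int_stable A" "A \<subseteq> Pow (space M)"
    and sets: "sets M = sigma_sets (space M) A"
  obtains C where "countable C" "C \<subseteq> square_integrable M" "L2_closure C = square_integrable M"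
proof -
  obtain Q :: "complex set" where Q: "countable Q" "\<And>X. open X \<Longrightarrow> X \<noteq> {} \<Longrightarrow> \<exists>d\<in>Q. d \<in> X"
    by (erule countable_dense_setE)
  \<comment> \<open>The complement step below subtracts from the indicator of the whole space, which
    \<open>A\<close> need not contain.\<close>
  define B where "B = insert (space M) A"
  have BM: "B \<subseteq> sets M" using sets by (auto simp: B_def intro: sigma_sets_top)
  \<comment> \<open>Lists of coefficient-set pairs make \<open>C\<close> countable and turn addition
    into concatenation.\<close>
  define F :: "(complex \<times> 'a set) list \<Rightarrow> 'a \<Rightarrow> complex"
    where "F xs = (\<lambda>x. \<Sum>(c, S)\<leftarrow>xs. c * indicator S x)" for xs
  define C where "C = F ` lists (Q \<times> B)"
  have ind: "(\<lambda>x. c * indicator S x) \<in> square_integrable M" if "S \<in> sets M" for c :: complex and S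
    by (rule square_integrable_bounded[of _ "cmod c"]) (use that in \<open>auto simp: indicator_def\<close>)
  have C_countable: "countable C"
    unfolding C_def using A(1) Q(1) by (intro countable_image countable_lists countable_SIGMA) (auto simp: B_def)
  have "F xs \<in> square_integrable M" if "xs \<in> lists (Q \<times> B)" for xs
    using that
  proof (induction xs)
    case (Cons y ys)
    obtain c S where y: "y = (c, S)" by (cases y)
    with Cons show ?case
      using square_integrable_add[OF ind[of S c], of "F ys"] BM by (auto simp: F_def)
  qed (simp add: F_def square_integrable_zero)
  then have C_sub: "C \<subseteq> square_integrable M" by (auto simp: C_def)
  have C_add: "(\<lambda>x. f x + g x) \<in> C" if f: "f \<in> C" and g: "g \<in> C" for f g
  proof -
    obtain xs ys where "xs \<in> lists (Q \<times> B)" "f = F xs" "ys \<in> lists (Q \<times> B)" "g = F ys"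
      using f g by (auto simp: C_def)
    then have "xs @ ys \<in> lists (Q \<times> B)" "(\<lambda>x. f x + g x) = F (xs @ ys)" by (auto simp: F_def)
    then show ?thesis unfolding C_def by blast
  qed
  have add: "(\<lambda>x. f x + g x) \<in> L2_closure C" if "f \<in> L2_closure C" "g \<in> L2_closure C" for f g
    using C_sub C_add that by (rule L2_closure_add)
  have base: "(\<lambda>x. c * indicator S x) \<in> L2_closure C" if S: "S \<in> B" for S and c :: complex
    unfolding L2_closure_def
  proof (safe intro!: ind)
    show "S \<in> sets M" using S BM by auto
    fix e :: real assume e: "e > 0"
    \<comment> \<open>Strictly above the total mass, so that dividing by \<open>m\<close> is sound
      for the zero measure too.\<close>
    define m where "m = measure M (space M) + 1"
    have m: "m > 0" "measure M (space M) < m" by (simp_all add: m_def add_nonneg_pos)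
    obtain d where d: "d \<in> Q" "d \<in> ball c (sqrt (e / m))"
      using Q(2)[of "ball c (sqrt (e / m))"] divide_pos_pos[OF e m(1)] by (auto simp del: zero_less_divide_iff)
    have cd: "(cmod (c - d))\<^sup>2 < e / m"
    proof -
      have "(cmod (c - d))\<^sup>2 < (sqrt (e / m))\<^sup>2"
        using d by (intro power_strict_mono) (auto simp: dist_norm)
      then show ?thesis using e m by simp
    qed
    have "(LINT x|M. (cmod (c * indicator S x - d * indicator S x))\<^sup>2) \<le> (LINT x|M. (cmod (c - d))\<^sup>2)"
    proof (rule integral_mono)
      show "integrable M (\<lambda>x. (cmod (c * indicator S x - d * indicator S x))\<^sup>2)"
        by (intro square_integrable_norm2 square_integrable_diff ind \<open>S \<in> sets M\<close>)
    qed (auto simp: indicator_def)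
    also have "\<dots> = (cmod (c - d))\<^sup>2 * measure M (space M)" by simp
    also have "\<dots> \<le> (cmod (c - d))\<^sup>2 * m" using m by (intro mult_left_mono) auto
    also have "\<dots> < e" using cd m by (simp add: field_simps)
    finally have "(LINT x|M. (cmod (c * indicator S x - d * indicator S x))\<^sup>2) < e" .
    moreover have "(\<lambda>x. d * indicator S x) \<in> C"
      unfolding C_def by (rule image_eqI[of _ _ "[(d, S)]"]) (use d S in \<open>auto simp: F_def\<close>)
    ultimately show "\<exists>g\<in>C. (LINT x|M. (cmod (c * indicator S x - g x))\<^sup>2) < e"
      by (intro bexI[of _ "\<lambda>x. d * indicator S x"])
  qed
  have zero: "(\<lambda>x. 0) \<in> L2_closure C"
    using base[of "space M" 0] by (simp add: B_def)
  \<comment> \<open>All scalars are treated together in the induction, since the complement step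
    uses the hypothesis for \<open>- c\<close>.\<close>
  have all: "\<forall>c. (\<lambda>x. c * indicator S x) \<in> L2_closure C" if "S \<in> sets M" for S
  proof -
    have "S \<in> sigma_sets (space M) A" using that sets by simp
    from A(2,3) this show ?thesis
    proof (induction rule: sigma_sets_induct_disjoint)
      case (basic S) then show ?case using base by (simp add: B_def)
    next
      case empty show ?case using zero by simp
    next
      case (compl S)
      have "(\<lambda>x. c * indicator (space M - S) x) \<in> L2_closure C" for c
      proof -
        have "(\<lambda>x. (- c) * indicator S x) \<in> L2_closure C" using compl.IH by blast
        from add[OF base this, of "space M" c]
        have "(\<lambda>x. c * indicator (space M) x + (- c) * indicator S x) \<in> L2_closure C"
          by (simp add: B_def)
        moreover have "S \<subseteq> space M" using compl(1) sets sets.sets_into_space by blast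
        then have "(\<lambda>x. c * indicator (space M) x + (- c) * indicator S x) =
            (\<lambda>x. c * indicator (space M - S) x)"
          by (auto simp: indicator_def fun_eq_iff)
        ultimately show ?thesis by simp
      qed
      then show ?case by blast
    next
      case (union S)
      have SM: "S i \<in> sets M" for i using union(2) sets by auto
      \<comment> \<open>Disjointness makes the indicator of a finite union a sum of indicators;
        dominated convergence then handles the countable union.\<close>
      have fin: "(\<lambda>x. c * indicator (\<Union>i<n. S i) x) \<in> L2_closure C" for c n
      proof (induction n)
        case 0 show ?case using zero by simp
      next
        case (Suc n)
        have "(\<lambda>x. c * indicator (\<Union>i<Suc n. S i) x) =
            (\<lambda>x. c * indicator (\<Union>i<n. S i) x + c * indicator (S n) x)"
        proof
          fix x
          have "x \<notin> S i" if "x \<in> S n" "i < n" for i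
            using disjoint_family_onD[OF union(1), of i n] that by auto
          then show "c * indicator (\<Union>i<Suc n. S i) x = c * indicator (\<Union>i<n. S i) x + c * indicator (S n) x"
            by (auto simp: indicator_def lessThan_Suc)
        qed
        then show ?case using add[OF Suc] union.IH by simp
      qed
      have "(\<lambda>x. c * indicator (\<Union>i. S i) x) \<in> L2_closure C" for c
      proof (rule L2_closure_dominated[OF C_sub fin])
        show "(\<lambda>n. c * indicator (\<Union>i<n. S i) x) \<longlonglongrightarrow> c * indicator (\<Union>i. S i) x" for x
          by (intro tendsto_intros LIMSEQ_indicator_UN)
        show "(\<lambda>x. c * indicator (\<Union>i. S i) x) \<in> square_integrable M" using SM by (intro ind) auto
      qed (auto simp: indicator_def)
      then show ?case by blast
    qed
  qed
  have "f \<in> L2_closure C" if f: "f \<in> square_integrable M" for f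
  proof -
    note [measurable] = f[THEN square_integrable_measurable]
    obtain s where s: "\<And>i. simple_function M (s i)"
        "\<And>x. x \<in> space M \<Longrightarrow> (\<lambda>i. s i x) \<longlonglongrightarrow> f x"
        "\<And>i x. x \<in> space M \<Longrightarrow> cmod (s i x) \<le> 2 * cmod (f x)"
      using borel_measurable_implies_sequence_metric[of f M 0] by simp metis
    have "(\<lambda>x. \<Sum>y\<in>s i ` space M. y * indicator (s i -` {y} \<inter> space M) x) \<in> L2_closure C" for i
    proof -
      have "(\<lambda>x. \<Sum>y\<in>Y. y * indicator (s i -` {y} \<inter> space M) x) \<in> L2_closure C"
        if "finite Y" for Y
        using that
      proof induction
        case (insert y Y)
        have "s i -` {y} \<inter> space M \<in> sets M" using s(1)[of i] by (rule simple_functionD)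
        then have "(\<lambda>x. y * indicator (s i -` {y} \<inter> space M) x) \<in> L2_closure C" using all by blast
        from add[OF this insert.IH] show ?case by (simp only: sum.insert[OF insert.hyps])
      qed (simp add: zero)
      then show ?thesis using simple_functionD(1)[OF s(1)] by blast
    qed
    then show ?thesis
    proof (rule L2_closure_dominated[OF C_sub _ f])
      fix x i assume x: "x \<in> space M"
      have eq: "(\<Sum>y\<in>s j ` space M. y * indicator (s j -` {y} \<inter> space M) x) = s j x" for j
        using simple_function_indicator_representation_banach[OF s(1) x, of j]
        by (simp only: scaleR_conv_of_real of_real_indicator mult.commute)
      show "(\<lambda>j. \<Sum>y\<in>s j ` space M. y * indicator (s j -` {y} \<inter> space M) x) \<longlonglongrightarrow> f x"
        using s(2)[OF x] by (simp only: eq)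
      show "cmod (\<Sum>y\<in>s i ` space M. y * indicator (s i -` {y} \<inter> space M) x) \<le> 2 * cmod (f x)"
        using s(3)[OF x] by (simp only: eq)
    qed
  qed
  then have "L2_closure C = square_integrable M" by (auto simp: L2_closure_def)
  then show thesis using that C_countable C_sub by blast
qed

lemma separable_hilbert_space_L2:
  assumes "countable A" "Int_stable A" "A \<subseteq> Pow (space M)" "sets M = sigma_sets (space M) A"
  shows "separable_hilbert_space (L2 M)"
proof -
  interpret L: complex_inner_space "L2 M" by (rule complex_inner_space_L2)
  interpret D: Metric_space "carrier (L2 M)" "cdist (L2 M)" by (rule L.Metric_space_cdist)
  obtain C where C: "countable C" "C \<subseteq> square_integrable M" "L2_closure C = square_integrable M"
    by (rule L2_countable_dense[OF assms])
  have "separable_space D.mtopology"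
    unfolding separable_space_def
  proof (intro exI conjI)
    show "countable (set_charge M ` C)" using C by simp
    have "set_charge M ` C \<subseteq> carrier (L2 M)" using C by (auto simp: carrier_L2)
    then show sub: "set_charge M ` C \<subseteq> topspace D.mtopology" by simp
    have "\<exists>v\<in>set_charge M ` C. v \<in> D.mball u e" if u: "u \<in> carrier (L2 M)" and e: "e > 0" for u e
    proof -
      obtain f where f: "f \<in> square_integrable M" "u = set_charge M f"
        using u by (auto simp: carrier_L2)
      then have "f \<in> L2_closure C" using C by simp
      then obtain g where g: "g \<in> C" "(LINT x|M. (cmod (f x - g x))\<^sup>2) < e\<^sup>2"
        using L2_closureD[of f C "e\<^sup>2"] e by auto
      then have gs: "g \<in> square_integrable M" using C by auto
      have "cdist (L2 M) u (set_charge M g) < e"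
        using f gs g e by (simp add: cdist_L2 real_less_lsqrt)
      then have "set_charge M g \<in> D.mball u e" using u g sub by auto
      then show ?thesis using g by blast
    qed
    then show "D.mtopology closure_of (set_charge M ` C) = topspace D.mtopology"
      by (auto simp: D.metric_closure_of)
  qed
  then show ?thesis
    using mcomplete_L2 L.complex_inner_space_axioms
    by (simp add: separable_hilbert_space_def separable_hilbert_space_axioms_def)
qed

end

text \<open>Finite intersections of a countable basis: this gives the stability that the Dynkin
  argument needs without losing countability. The empty intersection contributes
  \<open>UNIV\<close>.\<close>

lemma borel_countable_Int_stable_generator:
  obtains A :: "'a :: second_countable_topology set set"
  where "countable A" "Int_stable A" "borel = sigma UNIV A"
proof -
  obtain B :: "'a set set" where B: "countable B" "topological_basis B"
    using ex_countable_basis by blast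
  define A where "A = Inter ` {F. finite F \<and> F \<subseteq> B}"
  have "countable A"
    unfolding A_def using B(1) by (intro countable_image) (rule countable_Collect_finite_subset)
  moreover have "Int_stable A"
  proof (rule Int_stableI)
    fix S T assume "S \<in> A" "T \<in> A"
    then obtain F G where "finite F" "F \<subseteq> B" "S = \<Inter>F" "finite G" "G \<subseteq> B" "T = \<Inter>G"
      by (auto simp: A_def)
    then have "finite (F \<union> G)" "F \<union> G \<subseteq> B" "S \<inter> T = \<Inter>(F \<union> G)" by auto
    then show "S \<inter> T \<in> A" unfolding A_def by blast
  qed
  moreover have "borel = sigma UNIV A"
    unfolding borel_eq_countable_basis[OF B]
  proof (intro sigma_eqI sigma_sets_eqI)
    fix S assume "S \<in> B"
    then have "S \<in> A" unfolding A_def by (intro image_eqI[of _ _ "{S}"]) auto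
    then show "S \<in> sigma_sets UNIV A" by blast
  next
    fix S assume "S \<in> A"
    then obtain F where F: "finite F" "F \<subseteq> B" "S = \<Inter>F" by (auto simp: A_def)
    interpret sigma_algebra UNIV "sigma_sets UNIV B" by (rule sigma_algebra_sigma_sets) simp
    have "\<Inter>F \<in> sigma_sets UNIV B"
      using F(1,2)
    proof (induction F)
      case empty then show ?case using top by simp
    next
      case (insert T F) then show ?case by auto
    qed
    then show "S \<in> sigma_sets UNIV B" using F by simp
  qed auto
  ultimately show thesis by (rule that)
qed

text \<open>Intersecting the generator with \<open>S\<close> preserves countability and stability,
  and the trace of a generated sigma algebra is generated by the traces.\<close>

lemma separable_hilbert_space_L2_borel:
  fixes M :: "'a :: second_countable_topology measure"
  assumes "finite_measure M" and S: "S \<in> sets borel" and sets: "sets M = sets (restrict_space borel S)"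
  shows "separable_hilbert_space (L2 M)"
proof -
  interpret finite_measure M by fact
  obtain A :: "'a set set" where A: "countable A" "Int_stable A" "borel = sigma UNIV A"
    by (rule borel_countable_Int_stable_generator)
  have sp: "space M = S" using sets_eq_imp_space_eq[OF sets] by (simp add: space_restrict_space)
  show ?thesis
  proof (rule separable_hilbert_space_L2)
    show "countable ((\<inter>) S ` A)" using A by simp
    show "Int_stable ((\<inter>) S ` A)"
    proof (rule Int_stableI, safe)
      fix U V assume "U \<in> A" "V \<in> A"
      then have "U \<inter> V \<in> A" using A(2) by (auto simp: Int_stable_def)
      moreover have "S \<inter> U \<inter> (S \<inter> V) = S \<inter> (U \<inter> V)" by auto
      ultimately show "S \<inter> U \<inter> (S \<inter> V) \<in> (\<inter>) S ` A" by blast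
    qed
    show "(\<inter>) S ` A \<subseteq> Pow (space M)" by (auto simp: sp)
    show "sets M = sigma_sets (space M) ((\<inter>) S ` A)"
      using S unfolding sets sp sets_restrict_space A(3)
      by (simp add: sigma_sets_Int)
  qed
qed


section \<open>Multiplication operators\<close>

definition mult_op :: "'a measure \<Rightarrow> ('a \<Rightarrow> complex) \<Rightarrow> ('a set \<Rightarrow> complex) \<Rightarrow> 'a set \<Rightarrow> complex" where
  "mult_op M g u = set_charge M (\<lambda>x. g x * l2_rep M u x)"

locale unimodular_multiplier = finite_measure M for M :: "'a measure" +
  fixes g :: "'a \<Rightarrow> complex"
  assumes g_measurable [measurable]: "g \<in> borel_measurable M"
    and g_norm: "x \<in> space M \<Longrightarrow> cmod (g x) = 1"
begin

lemma square_integrable_multiplier: "f \<in> square_integrable M \<Longrightarrow> (\<lambda>x. g x * f x) \<in> square_integrable M"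
  by (rule square_integrable_mult_bounded) (simp_all add: g_norm)

text \<open>Multiplication by \<open>g\<close> respects almost everywhere equality, so the
  representative inside \<open>mult_op\<close> can be replaced by \<open>f\<close>.\<close>

lemma mult_op_set_charge:
  assumes f: "f \<in> square_integrable M"
  shows "mult_op M g (set_charge M f) = set_charge M (\<lambda>x. g x * f x)"
  unfolding mult_op_def using l2_rep_set_charge[OF f]
  by (subst set_charge_eq_iff) (auto intro!: square_integrable_multiplier f)

lemma mult_op_closed: "u \<in> carrier (L2 M) \<Longrightarrow> mult_op M g u \<in> carrier (L2 M)"
  by (auto simp: carrier_L2 mult_op_set_charge square_integrable_multiplier)

lemma funpow_mult_op:
  assumes f: "f \<in> square_integrable M"
  shows "(mult_op M g ^^ n) (set_charge M f) = set_charge M (\<lambda>x. g x ^ n * f x)"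
proof (induction n)
  case (Suc n)
  have "(\<lambda>x. g x ^ n * f x) \<in> square_integrable M"
    using f by (rule square_integrable_mult_bounded) (simp_all add: g_norm norm_power)
  then show ?case by (simp add: Suc mult_op_set_charge mult.assoc)
qed simp

text \<open>The reciprocal multiplier is again unimodular; its operator will be the inverse of
  \<open>mult_op M g\<close>.\<close>

interpretation inv: unimodular_multiplier M "\<lambda>x. inverse (g x)"
  by unfold_locales (simp_all add: norm_inverse g_norm)

lemma mult_op_inverse:
  assumes "u \<in> carrier (L2 M)"
  shows "mult_op M (\<lambda>x. inverse (g x)) (mult_op M g u) = u"
    and "mult_op M g (mult_op M (\<lambda>x. inverse (g x)) u) = u"
proof -
  obtain f where f: "f \<in> square_integrable M" "u = set_charge M f"
    using assms by (auto simp: carrier_L2)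
  have g0: "g x \<noteq> 0" if "x \<in> space M" for x using g_norm[OF that] by auto
  have "set_charge M (\<lambda>x. inverse (g x) * (g x * f x)) = set_charge M f"
    by (subst set_charge_eq_iff) (auto intro!: AE_I2 inv.square_integrable_multiplier
      square_integrable_multiplier f simp: g0)
  then show "mult_op M (\<lambda>x. inverse (g x)) (mult_op M g u) = u"
    using f by (simp add: mult_op_set_charge inv.mult_op_set_charge square_integrable_multiplier)
  have "set_charge M (\<lambda>x. g x * (inverse (g x) * f x)) = set_charge M f"
    by (subst set_charge_eq_iff) (auto intro!: AE_I2 inv.square_integrable_multiplier
      square_integrable_multiplier f simp: g0)
  then show "mult_op M g (mult_op M (\<lambda>x. inverse (g x)) u) = u"
    using f by (simp add: mult_op_set_charge inv.mult_op_set_charge inv.square_integrable_multiplier)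
qed

lemma bij_mult_op: "bij_betw (mult_op M g) (carrier (L2 M)) (carrier (L2 M))"
  by (rule bij_betw_byWitness[where f' = "mult_op M (\<lambda>x. inverse (g x))"])
    (auto simp: mult_op_inverse mult_op_closed inv.mult_op_closed)

lemma unitary_mult_op: "unitary_operator (L2 M) (mult_op M g)"
  unfolding unitary_operator_def
proof (intro conjI ballI allI bij_mult_op)
  fix u v a assume "u \<in> carrier (L2 M)" "v \<in> carrier (L2 M)"
  then obtain f h where fh: "f \<in> square_integrable M" "u = set_charge M f"
      "h \<in> square_integrable M" "v = set_charge M h"
    by (auto simp: carrier_L2)
  note mult = square_integrable_multiplier
  show "mult_op M g (u \<oplus>\<^bsub>L2 M\<^esub> v) = mult_op M g u \<oplus>\<^bsub>L2 M\<^esub> mult_op M g v"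
    using fh by (simp add: L2_add mult_op_set_charge square_integrable_add mult distrib_left)
  have "(LINT x|M. g x * f x * cnj (g x * h x)) = (LINT x|M. f x * cnj (h x))"
  proof (rule Bochner_Integration.integral_cong[OF refl])
    fix x assume "x \<in> space M"
    then have "g x * cnj (g x) = 1" using g_norm[of x] complex_norm_square[of "g x"] by simp
    then show "g x * f x * cnj (g x * h x) = f x * cnj (h x)"
      by (simp add: algebra_simps)
  qed
  then show "cip (L2 M) (mult_op M g u) (mult_op M g v) = cip (L2 M) u v"
    using fh by (simp add: cip_L2 mult_op_set_charge mult)
next
  fix u a assume "u \<in> carrier (L2 M)"
  then obtain f where f: "f \<in> square_integrable M" "u = set_charge M f"
    by (auto simp: carrier_L2)
  then show "mult_op M g (a \<odot>\<^bsub>L2 M\<^esub> u) = a \<odot>\<^bsub>L2 M\<^esub> mult_op M g u"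
    by (simp add: L2_smult mult_op_set_charge square_integrable_scale mult.left_commute)
qed

lemma op_powi_mult_op:
  assumes f: "f \<in> square_integrable M"
  shows "op_powi (L2 M) (mult_op M g) q (set_charge M f) = set_charge M (\<lambda>x. g x powi q * f x)"
proof (cases "q \<ge> 0")
  case True
  then show ?thesis using f by (simp add: op_powi_def funpow_mult_op power_int_def)
next
  case False
  let ?I = "inv_into (carrier (L2 M)) (mult_op M g)" and ?W = "mult_op M (\<lambda>x. inverse (g x))"
  have I: "?I u = ?W u" if "u \<in> carrier (L2 M)" for u
    using bij_mult_op that
    by (intro inv_into_f_eq) (auto simp: mult_op_inverse inv.mult_op_closed bij_betw_def)
  \<comment> \<open>\<open>?I\<close> and \<open>?W\<close> are known to agree only on the carrier,
    so the induction carries membership along.\<close>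
  have "(?I ^^ n) u = (?W ^^ n) u \<and> (?W ^^ n) u \<in> carrier (L2 M)" if "u \<in> carrier (L2 M)" for u n
    by (induction n) (use that I inv.mult_op_closed in auto)
  then show ?thesis
    using False f by (simp add: op_powi_def inv.funpow_mult_op carrier_L2 power_int_def)
qed

text \<open>An eigenvector with representative \<open>f\<close> satisfies
  \<open>(g x - a) * f x = 0\<close> almost everywhere. As the level set of \<open>g\<close> at
  \<open>a\<close> is null, \<open>f\<close> vanishes almost everywhere and its charge is
  zero.\<close>

lemma no_eigenvalue_mult_op:
  assumes "\<And>a. AE x in M. g x \<noteq> a"
  shows "\<not> (\<exists>a. is_eigenvalue (L2 M) (mult_op M g) a)"
proof
  assume "\<exists>a. is_eigenvalue (L2 M) (mult_op M g) a"
  then obtain a f where f: "f \<in> square_integrable M" "set_charge M f \<noteq> \<zero>\<^bsub>L2 M\<^esub>"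
      "mult_op M g (set_charge M f) = a \<odot>\<^bsub>L2 M\<^esub> set_charge M f"
    by (auto simp: is_eigenvalue_def carrier_L2)
  then have "AE x in M. g x * f x = a * f x"
    using set_charge_eq_iff[OF square_integrable_multiplier[OF f(1)] square_integrable_scale[OF f(1), of a]]
    by (simp add: mult_op_set_charge L2_smult)
  with assms[of a] have "AE x in M. f x = 0" by eventually_elim simp
  then show False
    using f set_charge_eq_iff[OF f(1) square_integrable_zero] by (simp add: L2_zero)
qed

end

section \<open>From a measure on the circle to the modified Kazhdan constant\<close>

lemma borel_measurable_power_int [measurable (raw)]:
  fixes f :: "'a \<Rightarrow> complex"
  shows "f \<in> borel_measurable M \<Longrightarrow> (\<lambda>x. f x powi n) \<in> borel_measurable M"
  by (cases "n \<ge> 0") (simp_all add: power_int_def)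

lemma continuous_circle_probD:
  assumes "continuous_circle_prob M"
  shows "prob_space M" and "sets M = sets (restrict_space borel unit_circle)"
    and "space M = unit_circle"
    and "(\<lambda>z. z) \<in> borel_measurable M"
    and "AE z in M. z \<noteq> a"
proof -
  show "prob_space M" and sets: "sets M = sets (restrict_space borel unit_circle)"
    using assms by (auto simp: continuous_circle_prob_def)
  interpret prob_space M by fact
  show sp: "space M = unit_circle"
    using sets_eq_imp_space_eq[OF sets] by (simp add: space_restrict_space)
  show id: "(\<lambda>z. z) \<in> borel_measurable M"
    by (simp add: measurable_cong_sets[OF sets refl] measurable_restrict_space1)
  show "AE z in M. z \<noteq> a"
  proof (cases "a \<in> unit_circle")
    case True
    then have "emeasure M {a} = 0"
      using assms by (simp add: continuous_circle_prob_def emeasure_eq_measure)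
    moreover have "{a} \<in> sets M"
      using True by (auto simp: sets sets_restrict_space intro!: image_eqI[of _ _ "{a}"])
    ultimately show ?thesis by (intro AE_I[of _ _ "{a}"]) auto
  qed (auto intro!: AE_I2 simp: sp)
qed

text \<open>As \<open>z powi q\<close> is unimodular, its squared distance from 1 is
  \<open>2 - 2 * Re (z powi q)\<close>. Integrating bounds the displacement of the constant 1
  uniformly over \<open>Q\<close>, and the gain is strict because \<open>c\<close> does not depend
  on \<open>q\<close>.\<close>

lemma modified_kazhdan_less_sqrt_2:
  assumes M: "continuous_circle_prob M" and c: "c > 0"
    and Q: "\<And>q. q \<in> Q \<Longrightarrow> c \<le> Re (circle_fourier M q)"
  shows "modified_kazhdan Q < ennreal (sqrt 2)"
proof -
  note D = continuous_circle_probD[OF M]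
  interpret prob_space M by (rule D)
  interpret unimodular_multiplier M "\<lambda>z. z"
    by unfold_locales (auto simp: D(3) intro: D(4))
  let ?V = "mult_op M (\<lambda>z. z)" and ?x = "set_charge M (\<lambda>_. 1)"
  have one: "(\<lambda>_. 1) \<in> square_integrable M"
    by (rule square_integrable_bounded[of _ 1]) auto
  have "cnorm (L2 M) (op_powi (L2 M) ?V q ?x \<ominus>\<^bsub>L2 M\<^esub> ?x) \<le> sqrt (2 - 2 * c)"
    if "q \<in> Q" for q
  proof -
    have norm: "cmod (z powi q) = 1" if "z \<in> space M" for z
      using that by (simp add: norm_power_int D(3))
    have [measurable]: "(\<lambda>z. z powi q) \<in> borel_measurable M" by measurable
    have int: "integrable M (\<lambda>z. z powi q)"
      by (rule integrable_const_bound[of _ 1]) (auto intro!: AE_I2 simp: norm)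
    have pw: "(\<lambda>z. z powi q) \<in> square_integrable M"
      by (rule square_integrable_bounded[of _ 1]) (auto simp: norm)
    have "(LINT z|M. (cmod (z powi q - 1))\<^sup>2) = (LINT z|M. 2 - 2 * Re (z powi q))"
    proof (rule Bochner_Integration.integral_cong[OF refl])
      fix z assume "z \<in> space M"
      then have "(cmod (z powi q))\<^sup>2 = 1" by (simp add: norm)
      then show "(cmod (z powi q - 1))\<^sup>2 = 2 - 2 * Re (z powi q)"
        unfolding cmod_power2 by (simp add: power2_eq_square algebra_simps)
    qed
    also have "\<dots> = 2 - 2 * Re (circle_fourier M q)"
      using int by (simp add: circle_fourier_def prob_space)
    also have "\<dots> \<le> 2 - 2 * c" using Q[OF that] by simp
    finally show ?thesis
      using one pw op_powi_mult_op[OF one, of q] by (simp add: L2_minus cnorm_L2 square_integrable_diff)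
  qed
  moreover have "?x \<in> {x \<in> carrier (L2 M). cnorm (L2 M) x = 1}"
    using one by (simp add: carrier_L2 cnorm_L2 prob_space)
  ultimately have "min_displacement Q (L2 M) ?V \<le> ennreal (sqrt (2 - 2 * c))"
    unfolding min_displacement_def by (intro INF_lower2[of ?x] SUP_least ennreal_leI) auto
  also have "\<dots> < ennreal (sqrt 2)" using c by (intro ennreal_lessI) auto
  finally have "min_displacement Q (L2 M) ?V < ennreal (sqrt 2)" .
  moreover have "modified_kazhdan Q \<le> min_displacement Q (L2 M) ?V"
  proof (rule modified_kazhdan_le)
    show "separable_hilbert_space (L2 M)"
      by (rule separable_hilbert_space_L2_borel[OF _ _ D(2)]) (auto intro: finite_measure_axioms)
  qed (use unitary_mult_op no_eigenvalue_mult_op D(5) in auto)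
  ultimately show ?thesis by (rule le_less_trans[rotated])
qed


section \<open>Operations on continuous measures\<close>

text \<open>Atoms of the image measure are probabilities of level sets of \<open>f\<close>. Both the
  symmetrised measure and the law of the random expansion are obtained through this lemma.\<close>

lemma continuous_circle_prob_distr:
  assumes "prob_space M" and f: "f \<in> borel_measurable M"
    and norm: "\<And>x. x \<in> space M \<Longrightarrow> cmod (f x) = 1" and ae: "\<And>a. AE x in M. f x \<noteq> a"
  shows "continuous_circle_prob (distr M (restrict_space borel unit_circle) f)"
    and "circle_fourier (distr M (restrict_space borel unit_circle) f) n = (LINT x|M. f x powi n)"
proof -
  interpret prob_space M by fact
  let ?R = "restrict_space borel unit_circle :: complex measure"
  have [measurable]: "f \<in> measurable M ?R"
    by (rule measurable_restrict_space2) (use f norm in auto)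
  have "measure (distr M ?R f) {z} = 0" if "z \<in> unit_circle" for z
  proof -
    have "{z} \<in> sets ?R"
      using that by (auto simp: sets_restrict_space intro!: image_eqI[of _ _ "{z}"])
    then have "measure (distr M ?R f) {z} = prob {x \<in> space M. f x = z}"
      by (simp add: measure_distr vimage_def Int_def conj_commute)
    also have "\<dots> = 0" using ae[of z] by (intro prob_eq_0_AE) auto
    finally show ?thesis .
  qed
  then show "continuous_circle_prob (distr M ?R f)"
    by (auto simp: continuous_circle_prob_def intro: prob_space_distr)
  have [measurable]: "(\<lambda>z. z powi n) \<in> borel_measurable ?R"
    by (intro borel_measurable_power_int measurable_restrict_space1) simp
  show "circle_fourier (distr M ?R f) n = (LINT x|M. f x powi n)"
    unfolding circle_fourier_def by (subst integral_distr) simp_all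
qed

text \<open>\<open>N\<close> is the law of \<open>z * cnj w\<close> for independent \<open>z\<close>
  and \<open>w\<close> distributed as \<open>M\<close>. Integer powers split over the product, so
  Fubini gives the coefficient of \<open>M\<close> times its conjugate.\<close>

lemma continuous_circle_prob_square:
  assumes M: "continuous_circle_prob M"
  obtains N where "continuous_circle_prob N"
    "\<And>n. circle_fourier N n = of_real ((cmod (circle_fourier M n))\<^sup>2)"
proof -
  note D = continuous_circle_probD[OF M]
  interpret prob_space M by (rule D)
  interpret P: pair_prob_space M M ..
  have m [measurable]: "(\<lambda>z. z) \<in> borel_measurable M" by (rule D)
  let ?f = "\<lambda>p. fst p * cnj (snd p)"
  have fst_m [measurable]: "fst \<in> borel_measurable (M \<Otimes>\<^sub>M M)"
    and snd_m [measurable]: "snd \<in> borel_measurable (M \<Otimes>\<^sub>M M)"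
    using measurable_compose[OF measurable_fst m] measurable_compose[OF measurable_snd m] by simp_all
  have f: "?f \<in> borel_measurable (M \<Otimes>\<^sub>M M)" by measurable
  have norm: "cmod (?f p) = 1" if "p \<in> space (M \<Otimes>\<^sub>M M)" for p
    using that by (auto simp: space_pair_measure D(3) norm_mult)
  have ae: "AE p in M \<Otimes>\<^sub>M M. ?f p \<noteq> a" for a
  proof (rule P.AE_pair_measure)
    show "{p \<in> space (M \<Otimes>\<^sub>M M). ?f p \<noteq> a} \<in> sets (M \<Otimes>\<^sub>M M)" by measurable
    show "AE z in M. AE w in M. ?f (z, w) \<noteq> a"
    proof (rule AE_I2)
      fix z assume "z \<in> space M"
      then have "z \<noteq> 0" by (auto simp: D(3))
      \<comment> \<open>For fixed \<open>z\<close> the value \<open>a\<close> can only be attained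
        at \<open>w = cnj (a / z)\<close>, a null point.\<close>
      show "AE w in M. ?f (z, w) \<noteq> a"
        using D(5)[of "cnj (a / z)"]
      proof eventually_elim
        case (elim w) with \<open>z \<noteq> 0\<close> show ?case by (auto simp: field_simps)
      qed
    qed
  qed
  note prod = P.prob_space_axioms f norm ae
  show thesis
  proof (rule that)
    show "continuous_circle_prob (distr (M \<Otimes>\<^sub>M M) (restrict_space borel unit_circle) ?f)"
      by (rule continuous_circle_prob_distr(1)[OF prod])
    fix n
    have "circle_fourier (distr (M \<Otimes>\<^sub>M M) (restrict_space borel unit_circle) ?f) n =
        (LINT p|(M \<Otimes>\<^sub>M M). ?f p powi n)"
      by (rule continuous_circle_prob_distr(2)[OF prod])
    also have "\<dots> = (LINT z|M. (LINT w|M. ?f (z, w) powi n))"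
    proof (rule P.integral_fst'[symmetric])
      show "integrable (M \<Otimes>\<^sub>M M) (\<lambda>p. ?f p powi n)"
        by (rule P.integrable_const_bound[of _ 1])
          (auto intro!: AE_I2 simp: norm_power_int norm simp del: norm_mult)
    qed
    also have "\<dots> = (LINT z|M. (LINT w|M. z powi n * cnj (w powi n)))"
      by (simp add: power_int_mult_distrib complex_cnj_power_int)
    also have "\<dots> = circle_fourier M n * cnj (circle_fourier M n)"
      by (simp add: circle_fourier_def del: complex_cnj_power_int)
    also have "\<dots> = of_real ((cmod (circle_fourier M n))\<^sup>2)"
      by (simp only: complex_norm_square)
    finally show "circle_fourier (distr (M \<Otimes>\<^sub>M M) (restrict_space borel unit_circle) ?f) n =
        of_real ((cmod (circle_fourier M n))\<^sup>2)" .
  qed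
qed

text \<open>The average is the mixture obtained by drawing \<open>i\<close> uniformly from
  \<open>I\<close>. Only real parts are recorded, which is all that the lower bound uses.\<close>

lemma continuous_circle_prob_average:
  assumes I: "finite I" "I \<noteq> {}" and M: "\<And>i. i \<in> I \<Longrightarrow> continuous_circle_prob (M i)"
  obtains N where "continuous_circle_prob N"
    "\<And>n. Re (circle_fourier N n) = (\<Sum>i\<in>I. Re (circle_fourier (M i) n)) / card I"
proof -
  obtain i0 where i0: "i0 \<in> I" using I by blast
  \<comment> \<open>The kernel must be a probability measure at every index, so indices outside
    \<open>I\<close> borrow the measure of \<open>i0\<close>; they are drawn with probability
    zero.\<close>
  define K where "K i = M (if i \<in> I then i else i0)" for i
  have K: "continuous_circle_prob (K i)" for i using M i0 by (simp add: K_def)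
  note KD = continuous_circle_probD[OF K]
  let ?R = "restrict_space borel unit_circle :: complex measure" and ?p = "pmf_of_set I"
  have Kp: "K i \<in> space (prob_algebra ?R)" for i
    using KD(1,2) by (simp add: space_prob_algebra)
  have meas: "K \<in> measurable (measure_pmf ?p) (subprob_algebra ?R)"
    using Kp by (auto simp: space_prob_algebra space_subprob_algebra prob_space_imp_subprob_space)
  define N where "N = measure_pmf ?p \<bind> K"
  have sets_N: "sets N = sets ?R"
    unfolding N_def by (rule sets_bind) (use KD(2) in auto)
  have bind: "emeasure N A = (\<integral>\<^sup>+i. emeasure (K i) A \<partial>measure_pmf ?p)" if "A \<in> sets ?R" for A
    unfolding N_def by (rule emeasure_bind[OF _ meas that]) simp
  show thesis
  proof (rule that)
    have "prob_space N"
    proof (rule prob_spaceI)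
      have "space N = unit_circle"
        using sets_eq_imp_space_eq[OF sets_N] by (simp add: space_restrict_space)
      moreover have "unit_circle \<in> sets ?R" by (auto simp: sets_restrict_space)
      moreover have "emeasure (K i) unit_circle = 1" for i
        using prob_space.emeasure_space_1[OF KD(1), of i] KD(3)[of i] by simp
      ultimately show "emeasure N (space N) = 1"
        using measure_pmf.emeasure_space_1[of ?p] by (simp add: bind)
    qed
    moreover have "measure N {z} = 0" if z: "z \<in> unit_circle" for z
    proof -
      have "{z} \<in> sets ?R"
        using z by (auto simp: sets_restrict_space intro!: image_eqI[of _ _ "{z}"])
      moreover have "emeasure (K i) {z} = 0" for i
        using K[of i] z finite_measure.emeasure_eq_measure[OF prob_space.finite_measure[OF KD(1)], of i]
        by (simp add: continuous_circle_prob_def)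
      ultimately show ?thesis by (simp add: bind measure_def)
    qed
    ultimately show "continuous_circle_prob N" using sets_N by (simp add: continuous_circle_prob_def)
    then interpret N: prob_space N by (rule continuous_circle_probD)
    \<comment> \<open>Taking the real part inside the integral leaves a bounded real integrand, to
      which \<open>integral_bind\<close> is applied.\<close>
    have re: "Re (circle_fourier L n) = (LINT z|L. Re (z powi n))" if L: "continuous_circle_prob L" for L n
    proof -
      note D = continuous_circle_probD[OF L]
      interpret prob_space L by (rule D)
      have "integrable L (\<lambda>z. z powi n)"
        by (rule integrable_const_bound[of _ 1])
          (auto intro!: AE_I2 borel_measurable_power_int D(4) simp: D(3) norm_power_int)
      then show ?thesis by (simp add: circle_fourier_def)
    qed
    fix n
    have "Re (circle_fourier N n) = (LINT z|N. Re (z powi n))" by (rule re) fact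
    also have "\<dots> = (LINT i|measure_pmf ?p. (LINT z|K i. Re (z powi n)))"
      unfolding N_def
    proof (rule integral_bind[where K = ?R and B = 1 and B' = 1])
      have "(\<lambda>z. z powi n) \<in> borel_measurable ?R"
        by (intro borel_measurable_power_int measurable_restrict_space1) simp
      then show "(\<lambda>z. Re (z powi n)) \<in> borel_measurable ?R" by measurable
      show "\<bar>Re (z powi n)\<bar> \<le> 1" if "z \<in> space ?R" for z
        using that abs_Re_le_cmod[of "z powi n"] by (simp add: space_restrict_space norm_power_int)
      show "AE i in measure_pmf ?p. emeasure (K i) (space (K i)) \<le> ennreal 1"
        using prob_space.emeasure_space_1[OF KD(1)] by simp
    qed (use meas measure_pmf.finite_measure_axioms in auto)
    also have "\<dots> = (\<Sum>i\<in>I. LINT z|K i. Re (z powi n)) / card I"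
      using I by (rule_tac integral_pmf_of_set) auto
    also have "\<dots> = (\<Sum>i\<in>I. Re (circle_fourier (M i) n)) / card I"
      using re[OF M] by (simp add: K_def)
    finally show "Re (circle_fourier N n) = (\<Sum>i\<in>I. Re (circle_fourier (M i) n)) / card I" .
  qed
qed


section \<open>Sparse random expansions\<close>

text \<open>A chord is no longer than its arc.\<close>

lemma cis_minus_one_le: "cmod (cis t - 1) \<le> \<bar>t\<bar>"
proof -
  have "cmod (cis t - 1) = 2 * \<bar>sin (t / 2)\<bar>" using dist_exp_i_1[of t] by (simp add: cis_conv_exp)
  also have "\<dots> \<le> \<bar>t\<bar>" using abs_sin_x_le_abs_x[of "t / 2"] by simp
  finally show ?thesis .
qed

locale sparse_expansion =
  fixes b P :: nat
  assumes b: "2 \<le> b" and bP: "b \<le> P"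
begin

text \<open>The exponents grow so fast that for \<open>k \<le> exponent j\<close> a frequency \<open>q \<le> P ^ k\<close> sees
  essentially nothing of the digits after \<open>j\<close>; if moreover \<open>b ^ k\<close> divides \<open>q\<close>, the digits whose exponent is at most \<open>k\<close>
  contribute integers. So at most one random digit influences \<open>circle_point \<omega> powi q\<close>.\<close>

definition exponent :: "nat \<Rightarrow> nat" where "exponent j = (P + 8) ^ j"

definition weight :: "nat \<Rightarrow> real" where "weight j = (1 / real b) ^ exponent j"

definition sparse_sum :: "(nat \<Rightarrow> bool) \<Rightarrow> real" where
  "sparse_sum \<omega> = (\<Sum>j. if \<omega> j then weight j else 0)"

section \<open>Decay of the weights and injectivity of the expansion\<close>

lemma weight_pos: "weight j > 0" using b by (simp add: weight_def)

text \<open>The term \<open>P * exponent j\<close> will absorb a frequency of size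
  \<open>P ^ exponent j\<close>, and the surplus \<open>8 * Suc i\<close> leaves geometric decay
  with ratio \<open>1 / 256\<close>.\<close>

lemma exponent_add_ge: "P * exponent j + 8 * Suc i \<le> exponent (j + Suc i)"
proof -
  have "P + 8 * Suc i \<le> (P + 8) ^ Suc i"
  proof (induction i)
    case (Suc i)
    have "P + 8 * Suc (Suc i) \<le> (P + 8 * Suc i) * 2" by simp
    also have "\<dots> \<le> (P + 8) ^ Suc i * (P + 8)" using Suc by (intro mult_le_mono) auto
    finally show ?case by (simp add: mult.commute)
  qed simp
  then have "(P + 8 * Suc i) * exponent j \<le> (P + 8) ^ Suc i * exponent j" by (rule mult_le_mono1)
  also have "\<dots> = exponent (j + Suc i)" by (simp only: exponent_def power_add mult.commute)
  finally have "(P + 8 * Suc i) * exponent j \<le> exponent (j + Suc i)" .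
  moreover have "8 * Suc i * 1 \<le> 8 * Suc i * exponent j" by (intro mult_le_mono2) (simp add: exponent_def)
  ultimately show ?thesis by (simp add: algebra_simps)
qed

text \<open>Since \<open>P \<le> b ^ P\<close>, the frequency factor is at most
  \<open>b ^ (P * exponent j)\<close>, which cancels against the weight by
  \<open>exponent_add_ge\<close>.\<close>

lemma tail_term_le: "real P ^ exponent j * weight (j + Suc i) \<le> (1 / 256) ^ Suc i"
proof -
  have "P \<le> 2 ^ P" using less_exp[of P] by simp
  also have "\<dots> \<le> b ^ P" using b by (rule power_mono) simp
  finally have "real P \<le> real b ^ P" by (metis of_nat_le_iff of_nat_power)
  then have "real P ^ exponent j \<le> (real b ^ P) ^ exponent j" by (intro power_mono) auto
  also have "\<dots> = real b ^ (P * exponent j)" by (simp add: power_mult)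
  finally have "real P ^ exponent j * weight (j + Suc i) \<le> real b ^ (P * exponent j) * weight (j + Suc i)"
    using weight_pos by (intro mult_right_mono) (auto intro: less_imp_le)
  also have "\<dots> \<le> real b ^ (P * exponent j) * (1 / real b) ^ (P * exponent j + 8 * Suc i)"
    unfolding weight_def using b by (intro mult_left_mono power_decreasing exponent_add_ge) auto
  also have "\<dots> = (1 / real b) ^ (8 * Suc i)"
    using b by (simp add: power_add power_one_over)
  also have "\<dots> \<le> (1 / 2) ^ (8 * Suc i)"
    using b by (intro power_mono) (auto simp: field_simps)
  also have "\<dots> = ((1 / 2) ^ 8) ^ Suc i" by (rule power_mult)
  also have "(1 / 2 :: real) ^ 8 = 1 / 256" by (simp add: power_one_over)
  finally show ?thesis .
qed

lemma tail_sums: "(\<lambda>i. (1 / 256 :: real) ^ Suc i) sums (1 / 255)"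
  using sums_mult[OF geometric_sums[of "1 / 256 :: real"], of "1 / 256"] by simp

lemma summable_digits: "summable (\<lambda>j. if \<omega> j then weight j else 0)"
proof (rule summable_comparison_test')
  show "summable (\<lambda>j. (1 / 2 :: real) ^ j)" by (simp add: summable_geometric)
  fix j
  have "(1 / real b) ^ exponent j \<le> (1 / real b) ^ j"
    using b less_exp[of j] power_mono[of 2 "P + 8" j] by (intro power_decreasing) (auto simp: exponent_def)
  also have "\<dots> \<le> (1 / 2) ^ j" using b by (intro power_mono) (auto simp: field_simps)
  finally show "norm (if \<omega> j then weight j else 0) \<le> (1 / 2) ^ j"
    using weight_pos[of j] by (auto simp: weight_def)
qed

definition tail :: "(nat \<Rightarrow> bool) \<Rightarrow> nat \<Rightarrow> real" where
  "tail \<omega> j = (\<Sum>i. if \<omega> (i + Suc j) then weight (i + Suc j) else 0)"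

lemma sparse_sum_split: "sparse_sum \<omega> = (\<Sum>i<j. if \<omega> i then weight i else 0) + (if \<omega> j then weight j else 0) + tail \<omega> j"
  using suminf_split_initial_segment[OF summable_digits, of \<omega> "Suc j"] by (simp add: sparse_sum_def tail_def)

lemma tail_bounds: "0 \<le> tail \<omega> j" "real P ^ exponent j * tail \<omega> j \<le> 1 / 255"
proof -
  have s: "summable (\<lambda>i. if \<omega> (i + Suc j) then weight (i + Suc j) else 0)"
    using summable_digits[of \<omega>] by (subst summable_iff_shift)
  show "0 \<le> tail \<omega> j" unfolding tail_def
    by (rule suminf_nonneg[OF s]) (auto intro: less_imp_le weight_pos)
  have "real P ^ exponent j * tail \<omega> j = (\<Sum>i. real P ^ exponent j * (if \<omega> (i + Suc j) then weight (i + Suc j) else 0))"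
    unfolding tail_def by (rule suminf_mult[OF s, symmetric])
  also have "\<dots> \<le> (\<Sum>i. (1 / 256) ^ Suc i)"
  proof (rule suminf_le)
    show "real P ^ exponent j * (if \<omega> (i + Suc j) then weight (i + Suc j) else 0) \<le> (1 / 256) ^ Suc i" for i
      using tail_term_le[of j i] by (simp add: add.commute)
    show "summable (\<lambda>i. real P ^ exponent j * (if \<omega> (i + Suc j) then weight (i + Suc j) else 0))"
      by (rule summable_mult[OF s])
    show "summable (\<lambda>i. (1 / 256 :: real) ^ Suc i)" by (rule sums_summable[OF tail_sums])
  qed
  also have "\<dots> = 1 / 255" using tail_sums by (simp add: sums_iff)
  finally show "real P ^ exponent j * tail \<omega> j \<le> 1 / 255" .
qed

text \<open>After multiplication by \<open>P ^ exponent j\<close>, the weight of digit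
  \<open>j\<close> is at least 1 because \<open>b \<le> P\<close>, while the whole tail is at most
  \<open>1 / 255\<close>.\<close>

lemma tail_less: "tail \<omega> j < weight j"
proof -
  have "1 \<le> real P ^ exponent j * weight j"
    using b bP by (simp add: weight_def flip: power_mult_distrib)
  moreover have "real P ^ exponent j * tail \<omega> j < 1" using tail_bounds(2)[of j \<omega>] by simp
  ultimately have "real P ^ exponent j * tail \<omega> j < real P ^ exponent j * weight j" by simp
  then show ?thesis using b bP by (simp add: mult_less_cancel_left_pos)
qed

text \<open>As \<open>exponent 0 = 1\<close>, the first weight is at most \<open>1 / 2\<close>, and
  it dominates the rest. Staying below 1 prevents wrapping around the circle.\<close>

lemma sparse_sum_bounds: "0 \<le> sparse_sum \<omega>" "sparse_sum \<omega> < 1"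
proof -
  show "0 \<le> sparse_sum \<omega>" unfolding sparse_sum_def
    by (rule suminf_nonneg[OF summable_digits]) (auto intro: less_imp_le weight_pos)
  have "weight 0 \<le> 1 / 2" using b by (simp add: weight_def exponent_def field_simps)
  then show "sparse_sum \<omega> < 1" using sparse_sum_split[of \<omega> 0] tail_less[of \<omega> 0] by auto
qed

text \<open>At the first digit where the sequences differ, one sum gains \<open>weight j\<close>,
  which exceeds the whole tail of the other.\<close>

lemma inj_sparse_sum: "inj sparse_sum"
proof (rule injI, rule ccontr)
  fix \<omega> \<omega>' :: "nat \<Rightarrow> bool" assume eq: "sparse_sum \<omega> = sparse_sum \<omega>'" and "\<omega> \<noteq> \<omega>'"
  then have "\<exists>j. \<omega> j \<noteq> \<omega>' j" by auto
  then obtain j where j: "\<omega> j \<noteq> \<omega>' j" and less: "\<And>i. i < j \<Longrightarrow> \<omega> i = \<omega>' i"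
    using exists_least_iff[of "\<lambda>j. \<omega> j \<noteq> \<omega>' j"] by auto
  have "(\<Sum>i<j. if \<omega> i then weight i else 0) = (\<Sum>i<j. if \<omega>' i then weight i else 0)"
    using less by (intro sum.cong) auto
  then show False
    using j eq sparse_sum_split[of \<omega> j] sparse_sum_split[of \<omega>' j] tail_less[of \<omega> j] tail_less[of \<omega>' j]
      tail_bounds(1)[of \<omega> j] tail_bounds(1)[of \<omega>' j] by (auto split: if_splits)
qed

definition circle_point :: "(nat \<Rightarrow> bool) \<Rightarrow> complex" where "circle_point \<omega> = cis (2 * pi * sparse_sum \<omega>)"

text \<open>Equal points have sums differing by an integer, which is 0 because both sums are at
  least 0 and less than 1.\<close>

lemma inj_circle_point: "inj circle_point"
proof (rule injI)
  fix \<omega> \<omega>' assume "circle_point \<omega> = circle_point \<omega>'"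
  then obtain n :: int where
    "\<i> * of_real (2 * pi * sparse_sum \<omega>) = \<i> * of_real (2 * pi * sparse_sum \<omega>') + of_real (of_int (2 * n) * pi) * \<i>"
    unfolding circle_point_def cis_conv_exp exp_eq by blast
  from arg_cong[OF this, of Im] have "2 * pi * sparse_sum \<omega> = 2 * pi * sparse_sum \<omega>' + 2 * pi * n" by simp
  then have "2 * pi * sparse_sum \<omega> = 2 * pi * (sparse_sum \<omega>' + n)" by (simp add: algebra_simps)
  then have *: "sparse_sum \<omega> = sparse_sum \<omega>' + n" by simp
  have "n = 0"
  proof -
    have "- 1 < real_of_int n" "real_of_int n < 1"
      using * sparse_sum_bounds[of \<omega>] sparse_sum_bounds[of \<omega>'] by linarith+
    then show ?thesis by linarith
  qed
  then show "\<omega> = \<omega>'" using * inj_sparse_sum by (simp add: inj_def)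
qed

text \<open>\<open>j\<close> is the first index with \<open>k < exponent j\<close>. It does not
  depend on \<open>\<omega>\<close>, so the exceptional event concerns one fixed digit, and there
  the trivial bound 2 for two points of the circle is used.\<close>

lemma circle_point_powi_close:
  assumes q: "0 < q" "int b ^ k dvd q" "q \<le> int P ^ k"
  obtains j where "\<And>\<omega>. cmod (circle_point \<omega> powi q - 1) \<le> 1 / 10 + (if \<omega> j then 2 else 0)"
proof -
  have "k < 2 ^ k" by (rule less_exp)
  also have "\<dots> \<le> exponent k" unfolding exponent_def by (rule power_mono) auto
  finally have "k < exponent k" .
  then obtain j where j: "k < exponent j" and less: "\<And>i. i < j \<Longrightarrow> exponent i \<le> k"
    using exists_least_iff[of "\<lambda>j. k < exponent j"] by (auto simp: not_less)
  have "cmod (circle_point \<omega> powi q - 1) \<le> 1 / 10 + (if \<omega> j then 2 else 0)" for \<omega>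
  proof (cases "\<omega> j")
    case True
    have "cmod (circle_point \<omega> powi q - 1) \<le> cmod (circle_point \<omega> powi q) + 1" by (metis norm_one norm_triangle_ineq4)
    then show ?thesis using True by (simp add: circle_point_def norm_power_int)
  next
    case False
    have "\<exists>m :: int. real_of_int q * (\<Sum>i<j. if \<omega> i then weight i else 0) = m"
    proof -
      have "\<exists>m :: int. real_of_int q * (if \<omega> i then weight i else 0) = m" if "i < j" for i
      proof -
        have "int b ^ exponent i dvd q"
          using le_imp_power_dvd[OF less[OF that]] q(2) by (rule dvd_trans)
        then obtain m where "q = int b ^ exponent i * m" by (auto simp: dvd_def)
        then have "real_of_int q * weight i = m" using b by (simp add: weight_def power_one_over)
        then show ?thesis by (metis mult_zero_right of_int_0)
      qed
      then obtain m where "\<And>i. i < j \<Longrightarrow> real_of_int q * (if \<omega> i then weight i else 0) = of_int (m i :: int)"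
        by metis
      then have "real_of_int q * (\<Sum>i<j. if \<omega> i then weight i else 0) = of_int (\<Sum>i<j. m i)"
        by (simp add: sum_distrib_left)
      then show ?thesis by blast
    qed
    then obtain m :: int where m: "real_of_int q * (\<Sum>i<j. if \<omega> i then weight i else 0) = m" by blast
    define t where "t = real_of_int q * tail \<omega> j"
    have "real_of_int q * sparse_sum \<omega> = m + t"
      using False m unfolding sparse_sum_split[of \<omega> j] t_def by (simp add: distrib_left)
    then have "circle_point \<omega> powi q = cis (2 * pi * m + 2 * pi * t)"
      unfolding circle_point_def cis_power_int by (simp add: mult.left_commute distrib_left flip: mult.assoc)
        (metis distrib_left mult.assoc mult.commute)
    also have "\<dots> = cis (2 * pi * t)" by (simp add: cis_multiple_2pi flip: cis_mult)
    finally have Zq: "circle_point \<omega> powi q = cis (2 * pi * t)" .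
    \<comment> \<open>Since \<open>k < exponent j\<close>, the bound
      \<open>q \<le> int P ^ k\<close> puts \<open>q\<close> in the range of
      \<open>tail_bounds\<close>.\<close>
    have "real_of_int q \<le> real P ^ exponent j"
    proof -
      have "int P ^ k \<le> int P ^ exponent j" using j b bP by (intro power_increasing) auto
      then have "q \<le> int P ^ exponent j" using q by simp
      then show ?thesis by (metis of_int_le_iff of_int_of_nat_eq of_int_power)
    qed
    then have "t \<le> real P ^ exponent j * tail \<omega> j"
      unfolding t_def by (intro mult_right_mono tail_bounds(1))
    then have "t \<le> 1 / 255" using tail_bounds(2)[of j \<omega>] by simp
    moreover have "0 \<le> t" using q tail_bounds(1) by (simp add: t_def)
    \<comment> \<open>With \<open>pi < 4\<close> the angle is at most \<open>8 / 255\<close>, below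
      the allowed \<open>1 / 10\<close>.\<close>
    moreover have "pi * t \<le> 4 * (1 / 255)"
      using calculation pi_less_4 by (intro mult_mono) auto
    ultimately have "\<bar>2 * pi * t\<bar> \<le> 2 * 4 * (1 / 255)" by (simp add: abs_mult)
    then show ?thesis using cis_minus_one_le[of "2 * pi * t"] False by (simp add: Zq)
  qed
  then show thesis by (rule that)
qed

section \<open>Independent random digits and their law on the circle\<close>

abbreviation "coin \<equiv> measure_pmf (bernoulli_pmf (1 / 4))"

interpretation coins: sequence_space coin ..

lemma borel_measurable_circle_point [measurable]: "circle_point \<in> borel_measurable coins.S"
proof -
  have [measurable]: "sparse_sum \<in> borel_measurable coins.S" unfolding sparse_sum_def by measurable
  have [measurable]: "cis \<in> borel_measurable borel"
    by (intro borel_measurable_continuous_onI continuous_on_cis continuous_on_id)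
  show ?thesis unfolding circle_point_def by measurable
qed

text \<open>The probability of a fixed sequence is a limit of products whose factors are
  \<open>1 / 4\<close> or \<open>3 / 4\<close>, hence at most \<open>3 / 4\<close>.\<close>

lemma coins_singleton: "emeasure coins.S {\<omega>} = 0" "{\<omega>} \<in> sets coins.S"
proof -
  have Pi: "Pi UNIV (\<lambda>i. {\<omega> i}) = {\<omega>}" by auto
  then show "{\<omega>} \<in> sets coins.S" using coins.infprod_in_sets[of "\<lambda>i. {\<omega> i}"] by simp
  have "(\<lambda>n. \<Prod>i\<le>n. measure coin {\<omega> i}) \<longlonglongrightarrow> measure coins.S {\<omega>}"
    using coins.measure_PiM_countable[of "\<lambda>i. {\<omega> i}"] by (simp add: Pi)
  moreover have "(\<lambda>n. \<Prod>i\<le>n. measure coin {\<omega> i}) \<longlonglongrightarrow> 0"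
  proof (rule tendsto_sandwich[OF _ _ tendsto_const])
    have "measure coin {x} \<le> 3 / 4" for x by (cases x) (simp_all add: measure_pmf_single)
    then have "(\<Prod>i\<le>n. measure coin {\<omega> i}) \<le> (\<Prod>i\<le>n. 3 / 4)" for n by (intro prod_mono) auto
    then show "\<forall>\<^sub>F n in sequentially. (\<Prod>i\<le>n. measure coin {\<omega> i}) \<le> (3 / 4) ^ Suc n" by simp
    show "(\<lambda>n. (3 / 4 :: real) ^ Suc n) \<longlonglongrightarrow> 0" by (rule LIMSEQ_Suc) (simp add: LIMSEQ_realpow_zero)
  qed (auto intro!: always_eventually prod_nonneg)
  ultimately show "emeasure coins.S {\<omega>} = 0"
    using LIMSEQ_unique coins.P.emeasure_eq_measure by (metis ennreal_0)
qed

text \<open>The expected distance from 1 is at most \<open>1 / 10 + 2 * (1 / 4) = 3 / 5\<close>. A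
  fair coin would only give a bound above 1, which says nothing; this is why the coin is
  biased.\<close>

lemma circle_prob_exists:
  obtains M where "continuous_circle_prob M"
    "\<And>q k. 0 < q \<Longrightarrow> int b ^ k dvd q \<Longrightarrow> q \<le> int P ^ k \<Longrightarrow> cmod (circle_fourier M q - 1) \<le> 3 / 5"
proof -
  have ae: "AE \<omega> in coins.S. circle_point \<omega> \<noteq> c" for c
  proof (cases "c \<in> range circle_point")
    case True
    then obtain \<omega>0 where "c = circle_point \<omega>0" by auto
    \<comment> \<open>Injectivity reduces a fibre to one sequence, which is a null set.\<close>
    then have "{\<omega>. circle_point \<omega> = c} = {\<omega>0}" using inj_circle_point by (auto simp: inj_def)
    then show ?thesis
      using coins_singleton[of \<omega>0] by (intro AE_I[of _ _ "{\<omega>0}"]) auto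
  qed (auto intro!: AE_I2)
  have norm: "cmod (circle_point \<omega>) = 1" for \<omega> by (simp add: circle_point_def)
  note M = coins.P.prob_space_axioms borel_measurable_circle_point norm ae
  let ?M = "distr coins.S (restrict_space borel unit_circle) circle_point"
  show thesis
  proof (rule that[of ?M])
    show "continuous_circle_prob ?M" by (rule continuous_circle_prob_distr(1)[OF M])
    fix q k assume q: "0 < q" "int b ^ k dvd q" "q \<le> int P ^ k"
    obtain j where j: "\<And>\<omega>. cmod (circle_point \<omega> powi q - 1) \<le> 1 / 10 + (if \<omega> j then 2 else 0)"
      using circle_point_powi_close[OF q] by blast
    have int: "integrable coins.S (\<lambda>\<omega>. circle_point \<omega> powi q)"
      by (rule coins.P.integrable_const_bound[of _ 1]) (auto simp: norm norm_power_int)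
    have set: "{\<omega> \<in> space coins.S. \<omega> j} \<in> sets coins.S" by measurable
    have "measure coins.S {\<omega> \<in> space coins.S. \<omega> j} = 1 / 4"
      using coins.emeasure_PiM_Collect_single[of j "{True}"]
      by (simp add: measure_def emeasure_pmf_single)
    moreover have "(\<lambda>\<omega>. 1 / 10 + (if \<omega> j then 2 else 0 :: real)) =
        (\<lambda>\<omega>. 1 / 10 + 2 * indicator {\<omega> \<in> space coins.S. \<omega> j} \<omega>)"
      by (auto simp: fun_eq_iff indicator_def space_PiM)
    ultimately have I: "integrable coins.S (\<lambda>\<omega>. 1 / 10 + (if \<omega> j then 2 else 0 :: real))"
        "(LINT \<omega>|coins.S. 1 / 10 + (if \<omega> j then 2 else 0 :: real)) = 3 / 5"
      using set by (simp_all add: coins.P.prob_space coins.P.emeasure_eq_measure)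
    have "circle_fourier ?M q - 1 = (LINT \<omega>|coins.S. circle_point \<omega> powi q - 1)"
      using int by (simp add: continuous_circle_prob_distr(2)[OF M] coins.P.prob_space)
    also have "cmod \<dots> \<le> (LINT \<omega>|coins.S. 1 / 10 + (if \<omega> j then 2 else 0))"
      using int I(1) j by (intro order_trans[OF integral_norm_bound integral_mono]) auto
    also have "\<dots> = 3 / 5" by (rule I)
    finally show "cmod (circle_fourier ?M q - 1) \<le> 3 / 5" .
  qed
qed

end


section \<open>The multiplicative semigroup\<close>

text \<open>\<open>K\<close> is the largest exponent among the bases different from 1. Bases equal
  to 1 are left out, since a large exponent on one of them does not make a power of 2 divide the
  product. If all bases are 1, the product is 1 and \<open>K = 0\<close>.\<close>

lemma dominant_power:
  fixes p :: "nat \<Rightarrow> int" and k :: "nat \<Rightarrow> nat"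
  assumes I: "finite I" "I \<noteq> {}" and pos: "\<And>i. i \<in> I \<Longrightarrow> p i > 0"
  obtains i K where "i \<in> I" "(if p i = 1 then 2 else p i) ^ K dvd (\<Prod>i\<in>I. p i ^ k i)"
    "(\<Prod>i\<in>I. p i ^ k i) \<le> (2 * (\<Prod>i\<in>I. p i)) ^ K"
proof (cases "\<forall>i\<in>I. p i = 1")
  case True
  moreover obtain i where "i \<in> I" using I by blast
  ultimately show ?thesis by (intro that[of i 0]) auto
next
  case False
  define J where "J = {i \<in> I. p i \<noteq> 1}"
  have J: "finite J" "J \<noteq> {}" using I False by (auto simp: J_def)
  obtain i where i: "i \<in> J" and le: "\<And>l. l \<in> J \<Longrightarrow> k l \<le> k i"
    using Max_in[of "k ` J"] Max_ge[of "k ` J"] J by (metis (no_types, lifting) finite_imageI image_iff image_is_empty)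
  have iI: "i \<in> I" "p i \<noteq> 1" using i by (auto simp: J_def)
  show ?thesis
  proof (rule that)
    show "i \<in> I" by fact
    show "(if p i = 1 then 2 else p i) ^ k i dvd (\<Prod>i\<in>I. p i ^ k i)"
      using iI dvd_prodI[OF I(1) iI(1), of "\<lambda>i. p i ^ k i"] by simp
    have "(\<Prod>l\<in>I. p l ^ k l) \<le> (\<Prod>l\<in>I. p l ^ k i)"
    proof (rule prod_mono, safe)
      fix l assume l: "l \<in> I"
      show "0 \<le> p l ^ k l" using pos[OF l] by simp
      \<comment> \<open>A base 1 contributes 1 whatever its exponent; the other exponents are at
        most \<open>k i\<close>.\<close>
      show "p l ^ k l \<le> p l ^ k i"
        using pos[OF l] le[of l] l by (cases "p l = 1") (auto simp: J_def intro!: power_increasing)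
    qed
    also have "\<dots> = (\<Prod>l\<in>I. p l) ^ k i" by (rule prod_power_distrib[symmetric])
    also have "\<dots> \<le> (2 * (\<Prod>l\<in>I. p l)) ^ k i"
      using prod_pos[of I p] pos by (intro power_mono) auto
    finally show "(\<Prod>l\<in>I. p l ^ k l) \<le> (2 * (\<Prod>l\<in>I. p l)) ^ k i" .
  qed
qed

theorem theorem2p1:
  fixes r :: nat and p :: "nat \<Rightarrow> int" and E :: "int set"
  assumes r: "r \<ge> 1"
    and pos: "\<And>i. i \<in> {1..r} \<Longrightarrow> p i > 0"
    and distinct: "inj_on p {1..r}"
    and E: "E = {(\<Prod>i=1..r. p i ^ k i) | k :: nat \<Rightarrow> nat. True}"
  shows "(\<exists>\<mu>. continuous_circle_prob \<mu> \<and>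
            (INF k :: nat \<Rightarrow> nat. cmod (circle_fourier \<mu> (\<Prod>i=1..r. p i ^ k i))) > 0) \<and>
         modified_kazhdan E < ennreal (sqrt 2)"
proof -
  define B where "B i = (if p i = 1 then 2 else p i)" for i
  \<comment> \<open>Bases equal to 1 are replaced by 2, and the factor 2 in \<open>P\<close> ensures \<open>B i \<le> P\<close> also for those.\<close>
  define P where "P = 2 * (\<Prod>i=1..r. p i)"
  have P: "2 \<le> P" using prod_pos[of "{1..r}" p] pos by (auto simp: P_def)
  have "\<exists>M. continuous_circle_prob M \<and> (\<forall>q K. 0 < q \<longrightarrow> B i ^ K dvd q \<longrightarrow> q \<le> P ^ K \<longrightarrow>
      cmod (circle_fourier M q - 1) \<le> 3 / 5)" if i: "i \<in> {1..r}" for i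
  proof -
    \<comment> \<open>A divisor of a positive integer does not exceed it.\<close>
    have "p i \<le> (\<Prod>i=1..r. p i)"
      using dvd_prodI[of "{1..r}" i p] i prod_pos[of "{1..r}" p] pos by (auto intro: zdvd_imp_le)
    then have "2 \<le> B i" "B i \<le> P" using pos[OF i] P by (auto simp: B_def P_def)
    then interpret sparse_expansion "nat (B i)" "nat P" by unfold_locales auto
    have "int (nat (B i)) = B i" "int (nat P) = P" using \<open>2 \<le> B i\<close> P by simp_all
    then show ?thesis using circle_prob_exists by metis
  qed
  then obtain M where M: "\<And>i. i \<in> {1..r} \<Longrightarrow> continuous_circle_prob (M i)"
    and close: "\<And>i q K. i \<in> {1..r} \<Longrightarrow> 0 < q \<Longrightarrow> B i ^ K dvd q \<Longrightarrow> q \<le> P ^ K \<Longrightarrow>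
      cmod (circle_fourier (M i) q - 1) \<le> 3 / 5"
    by metis
  \<comment> \<open>Nonnegative coefficients, so that nothing cancels in the average over \<open>i\<close>.\<close>
  have "\<exists>N. continuous_circle_prob N \<and>
      (\<forall>n. circle_fourier N n = of_real ((cmod (circle_fourier (M i) n))\<^sup>2))" if "i \<in> {1..r}" for i
    using continuous_circle_prob_square[OF M[OF that]] by metis
  then obtain N where N: "\<And>i. i \<in> {1..r} \<Longrightarrow> continuous_circle_prob (N i)"
    and square: "\<And>i n. i \<in> {1..r} \<Longrightarrow>
      circle_fourier (N i) n = of_real ((cmod (circle_fourier (M i) n))\<^sup>2)"
    by metis
  obtain \<mu> where \<mu>: "continuous_circle_prob \<mu>"
    and avg: "\<And>n. Re (circle_fourier \<mu> n) = (\<Sum>i=1..r. Re (circle_fourier (N i) n)) / card {1..r}"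
    using continuous_circle_prob_average[of "{1..r}" N] N r by auto
  \<comment> \<open>\<open>4 / 25\<close> is the square of \<open>2 / 5 = 1 - 3 / 5\<close>; the
    division by \<open>r\<close> is there because only one summand of the average is known to be
    large.\<close>
  define c where "c = 4 / 25 / real r"
  have c: "c > 0" using r by (simp add: c_def)
  have lower: "c \<le> Re (circle_fourier \<mu> (\<Prod>i=1..r. p i ^ k i))" for k
  proof -
    define q where "q = (\<Prod>i=1..r. p i ^ k i)"
    obtain i K where i: "i \<in> {1..r}" and "B i ^ K dvd q" "q \<le> P ^ K"
      using dominant_power[of "{1..r}" p k] pos r unfolding q_def B_def P_def by auto
    moreover have "0 < q" unfolding q_def using pos by (intro prod_pos) auto
    ultimately have "cmod (circle_fourier (M i) q - 1) \<le> 3 / 5" by (intro close)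
    then have "2 / 5 \<le> cmod (circle_fourier (M i) q)"
      using norm_triangle_ineq2[of 1 "circle_fourier (M i) q"] by (simp add: norm_minus_commute)
    then have "(2 / 5)\<^sup>2 \<le> (cmod (circle_fourier (M i) q))\<^sup>2" by (rule power_mono) simp
    also have "\<dots> = Re (circle_fourier (N i) q)" using square[OF i] by simp
    also have "\<dots> \<le> (\<Sum>i=1..r. Re (circle_fourier (N i) q))"
      using i square by (intro member_le_sum) auto
    finally have "c \<le> Re (circle_fourier \<mu> q)"
      using r by (simp add: avg c_def power2_eq_square field_simps)
    then show ?thesis by (simp only: q_def)
  qed
  \<comment> \<open>The bound on real parts serves twice: for the moduli here and for the
    displacements below.\<close>
  have "c \<le> (INF k :: nat \<Rightarrow> nat. cmod (circle_fourier \<mu> (\<Prod>i=1..r. p i ^ k i)))"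
    using order_trans[OF lower complex_Re_le_cmod] by (intro cINF_greatest) auto
  moreover have "modified_kazhdan E < ennreal (sqrt 2)"
    using \<mu> c by (rule modified_kazhdan_less_sqrt_2) (use E lower in auto)
  ultimately show ?thesis using \<mu> c by (meson less_le_trans)
qed

end
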